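(* Let $\ell$ be a prime, let $L_0=\mathbb{Z}^2$, and let $M_0\subset L_0$ be a sublattice of index $\ell$. Let $ax^2+bxy+ay^2$ be a primitive reduced positive definite integral form on $L_0$ (so $\gcd(a,b)=1$) which, with the pair $(L_0,M_0)$, is a doubly well-rounded form, and let $D=b^2-4a^2$ be its discriminant. Restrict the form to $M_0$, write it in coordinates with respect to a $\mathbb{Z}$-basis of $M_0$, and reduce it; the resulting reduced form, not necessarily primitive, is $(u,v,u)$ for some integers $u,v$. Then $\gcd(u,v)=\ell$. Letting $u_1=u/\ell$ and $v_1=v/\ell$, the form $(u_1,v_1,u_1)$ is a primitive and reduced form on $M_0$ of discriminant $D$. The lattice $L_0$ and the sublattice $M_0$ have the same coefficient ring. The temperament $\tau$ of this doubly well-rounded form satisfies $$\tau^2=\ell\,\frac{u_1}{a}.$$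
   Context: Write $(a,b,c)$ for the form $ax^2+bxy+cy^2$; its matrix is $\begin{bmatrix} a&b/2\\ b/2&c\end{bmatrix}$ and its discriminant is $b^2-4ac$. All forms are positive definite. An integral form is primitive if $\gcd(a,b,c)=1$, and reduced if $|b|\leqslant a\leqslant c$, with $b\leqslant 0$ whenever $|b|=a$ or $a=c$. Reducing a form means replacing it by the unique reduced form properly equivalent to it (i.e. via $\mathrm{SL}_2(\mathbb{Z})$). Tempered perfect forms: a positive definite quadratic form $A$ on $L_0=\mathbb{Z}^2$ is a tempered perfect form for a sublattice $M_0$ of prime index $\ell$ if, after multiplying $A$ by a positive scalar, there exist non-empty sets $S\subset L_0-M_0$ and $S'\subset M_0-\{0\}$ such that (i) $vAv^T=1$ for all $v\in S$; (ii) $vAv^T>1$ for all $v\in L_0-M_0$ with $v\notin S$; (iii) $vAv^T$ has a common value, say $U\geqslant1$, for all $v\in S'$; (iv) $vAv^T>U$ for all $v\in M_0-\{0\}$ with $v\notin S'$; (v) if $B$ is any positive definite quadratic form satisfying (i)--(iv) in place of $A$ with the same $S,S'$ and with common value $U'$ on $S'$, then $B=A$ and $U'=U$. The temperament is $\tau=\sqrt{U}$. It is doubly well-rounded if $S$ contains at least two pairs $\pm v$ and $S'$ contains at least two pairs $\pm v$. Coefficient rings: embed $L_0$ in $K=\mathbb{Q}(\sqrt D)\subset\mathbb{C}$ by $(x,y)\mapsto x+y\gamma$, $\gamma=\frac{b+\sqrt D}{2a}$, so that the form becomes a multiple of the squared absolute value. The coefficient ring of a lattice $\Lambda\subset K$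 is $\{\alpha\in K\mid\alpha\Lambda\subseteq\Lambda\}$; the coefficient rings of $L_0$ and $M_0$ are those of their images in $K$. *)

theory Defs
  imports Complex_Main "HOL-Library.Product_Plus" "HOL-Computational_Algebra.Primes"
begin

(* BQF a b c stands for a x^2 + b x y + c y^2.  Integral forms are int bqf; general quadratic
   forms on Z^2 are real bqf, and map_bqf real_of_int is the inclusion. *)
datatype 'a bqf = BQF 'a 'a 'a

fun bqf_val :: "'a::comm_ring_1 bqf \<Rightarrow> 'a \<Rightarrow> 'a \<Rightarrow> 'a" where
  "bqf_val (BQF a b c) x y = a * x\<^sup>2 + b * x * y + c * y\<^sup>2"

definition bqf_at :: "'a::comm_ring_1 bqf \<Rightarrow> int \<times> int \<Rightarrow> 'a" where
  "bqf_at F v = bqf_val F (of_int (fst v)) (of_int (snd v))"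

fun discr :: "'a::comm_ring_1 bqf \<Rightarrow> 'a" where
  "discr (BQF a b c) = b\<^sup>2 - 4 * a * c"

(* Real vectors are needed here: positivity at the nonzero integer vectors alone does not make
   a real form positive definite. *)
definition pos_def :: "real bqf \<Rightarrow> bool" where
  "pos_def F \<longleftrightarrow> (\<forall>x y. (x, y) \<noteq> (0, 0) \<longrightarrow> bqf_val F x y > 0)"

definition smult_bqf :: "'a::times \<Rightarrow> 'a bqf \<Rightarrow> 'a bqf" where
  "smult_bqf k F = map_bqf ((*) k) F"

fun primitive :: "int bqf \<Rightarrow> bool" where
  "primitive (BQF a b c) \<longleftrightarrow> gcd a (gcd b c) = 1"

fun reduced :: "int bqf \<Rightarrow> bool" where
  "reduced (BQF a b c) \<longleftrightarrow>
     \<bar>b\<bar> \<le> a \<and> a \<le> c \<and> (\<bar>b\<bar> = a \<or> a = c \<longrightarrow> b \<le> 0)"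

definition lin_comb :: "int \<times> int \<Rightarrow> int \<times> int \<Rightarrow> int \<times> int \<Rightarrow> int \<times> int" where
  "lin_comb p q w = (fst w * fst p + snd w * fst q, fst w * snd p + snd w * snd q)"

(* The form (i, j) \<mapsto> F (i p + j q); see bqf_at_in_coords. *)
definition in_coords :: "int bqf \<Rightarrow> int \<times> int \<Rightarrow> int \<times> int \<Rightarrow> int bqf" where
  "in_coords F p q = BQF (bqf_at F p) (bqf_at F (p + q) - bqf_at F p - bqf_at F q) (bqf_at F q)"

lemma bqf_at_in_coords: "bqf_at (in_coords F p q) w = bqf_at F (lin_comb p q w)"
  by (cases F) (simp add: in_coords_def bqf_at_def lin_comb_def algebra_simps power2_eq_square)

definition properly_equivalent :: "int bqf \<Rightarrow> int bqf \<Rightarrow> bool" where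
  "properly_equivalent F G \<longleftrightarrow>
     (\<exists>p q. fst p * snd q - fst q * snd p = 1 \<and> G = in_coords F p q)"

definition reduction :: "int bqf \<Rightarrow> int bqf" where
  "reduction F = (THE G. reduced G \<and> properly_equivalent F G)"

definition sublattice :: "(int \<times> int) set \<Rightarrow> bool" where
  "sublattice M \<longleftrightarrow> 0 \<in> M \<and> (\<forall>v\<in>M. \<forall>w\<in>M. v - w \<in> M)"

(* 0 if the index is infinite. *)
definition lattice_index :: "(int \<times> int) set \<Rightarrow> nat" where
  "lattice_index M = card (UNIV // {(v, w). v - w \<in> M})"

definition int_basis :: "(int \<times> int) set \<Rightarrow> int \<times> int \<Rightarrow> int \<times> int \<Rightarrow> bool" where
  "int_basis M p q \<longleftrightarrow> bij_betw (lin_comb p q) UNIV M"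

(* Here and in normalized_tempered_perfect, A is already scaled so that its minimum outside M is 1;
   U is the minimum on M - {0}. *)
definition tempered ::
  "(int \<times> int) set \<Rightarrow> (int \<times> int) set \<Rightarrow> (int \<times> int) set \<Rightarrow> real bqf \<Rightarrow> real \<Rightarrow> bool" where
  "tempered M S S' A U \<longleftrightarrow>
     (\<forall>v\<in>S. bqf_at A v = 1) \<and>
     (\<forall>v. v \<notin> M \<and> v \<notin> S \<longrightarrow> bqf_at A v > 1) \<and>
     U \<ge> 1 \<and> (\<forall>v\<in>S'. bqf_at A v = U) \<and>
     (\<forall>v\<in>M - {0}. v \<notin> S' \<longrightarrow> bqf_at A v > U)"

definition normalized_tempered_perfect ::
  "(int \<times> int) set \<Rightarrow> (int \<times> int) set \<Rightarrow> (int \<times> int) set \<Rightarrow> real bqf \<Rightarrow> real \<Rightarrow> bool" where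
  "normalized_tempered_perfect M S S' A U \<longleftrightarrow>
     S \<noteq> {} \<and> S \<subseteq> - M \<and> S' \<noteq> {} \<and> S' \<subseteq> M - {0} \<and>
     pos_def A \<and> tempered M S S' A U \<and>
     (\<forall>B U'. pos_def B \<and> tempered M S S' B U' \<longrightarrow> B = A \<and> U' = U)"

definition two_pairs :: "(int \<times> int) set \<Rightarrow> bool" where
  "two_pairs S \<longleftrightarrow> (\<exists>v w. {v, - v, w, - w} \<subseteq> S \<and> w \<noteq> v \<and> w \<noteq> - v)"

definition doubly_well_rounded :: "real bqf \<Rightarrow> (int \<times> int) set \<Rightarrow> bool" where
  "doubly_well_rounded A M \<longleftrightarrow>
     (\<exists>k>0. \<exists>S S' U. normalized_tempered_perfect M S S' (smult_bqf k A) U \<and>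
        two_pairs S \<and> two_pairs S')"

(* The scalar is forced, since the minimum outside M becomes 1; hence U is unique. *)
definition temperament :: "real bqf \<Rightarrow> (int \<times> int) set \<Rightarrow> real" where
  "temperament A M =
     sqrt (THE U. \<exists>k>0. \<exists>S S'. normalized_tempered_perfect M S S' (smult_bqf k A) U)"

definition quad_field :: "int \<Rightarrow> complex set" where
  "quad_field D = {r + s * csqrt (of_int D) | r s. r \<in> \<rat> \<and> s \<in> \<rat>}"

fun field_embed :: "int bqf \<Rightarrow> int \<times> int \<Rightarrow> complex" where
  "field_embed (BQF a b c) (x, y) =
     of_int x + of_int y * ((of_int b + csqrt (of_int (discr (BQF a b c)))) / (2 * of_int a))"

definition coefficient_ring :: "complex set \<Rightarrow> complex set \<Rightarrow> complex set" where
  "coefficient_ring K \<Lambda> = {\<alpha> \<in> K. \<forall>z\<in>\<Lambda>. \<alpha> * z \<in> \<Lambda>}"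

end

theory Submission
  imports Defs
begin

text \<open>
  In a doubly well-rounded form the minimal vectors of \<open>Z\<^sup>2\<close> lie outside \<open>M\<close>, and two minimal vectors
  \<open>p\<close>, \<open>q\<close> of \<open>M\<close>, of value \<open>u\<close>, form a basis of \<open>M\<close>. Both \<open>(1, 1), (1, -1)\<close> and \<open>p + q, p - q\<close> are
  orthogonal pairs, with values \<open>P = 2a + b\<close>, \<open>N = 2a - b\<close> and \<open>2u + v\<close>, \<open>2u - v\<close>. Expressing the
  second pair in the first shows that \<open>l\<close> divides \<open>2u + v\<close> unless \<open>p - q\<close> lies in \<open>l Z\<^sup>2\<close>, and \<open>2u - v\<close>
  unless \<open>p + q\<close> does; since \<open>3 u\<^sup>2 \<le> l\<^sup>2 P N \<le> 4 a\<^sup>2 l\<^sup>2\<close>, such a vector would be too long once \<open>l \<ge> 5\<close>.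
  Likewise \<open>l\<^sup>2\<close> dividing \<open>u\<close> and \<open>v\<close> would force \<open>(1, 1)\<close> or \<open>(1, -1)\<close> into \<open>M\<close>, which makes \<open>u\<close> too small.
  For \<open>l = 2\<close> and \<open>l = 3\<close> only the square and the hexagonal form survive.
  Once \<open>gcd u v = l\<close> is known, both lattices carry primitive forms of discriminant \<open>D\<close>, and a primitive
  form \<open>(u, v, u)\<close> of discriminant \<open>D\<close> has coefficient ring \<open>Z + Z (v + sqrt D) / 2\<close>.
\<close>

section \<open>Sublattices of finite index\<close>

lemma sublattice_lin_comb:
  assumes "sublattice M" "p \<in> M" "q \<in> M"
  shows "lin_comb p q w \<in> M"
proof -
  have diff: "v - w \<in> M" if "v \<in> M" "w \<in> M" for v w
    using assms(1) that by (auto simp: sublattice_def)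
  have zero: "0 \<in> M" using assms(1) by (auto simp: sublattice_def)
  have neg: "- v \<in> M" if "v \<in> M" for v
    using diff[OF zero that] by simp
  have add: "v + w \<in> M" if "v \<in> M" "w \<in> M" for v w
    using diff[OF that(1) neg[OF that(2)]] by simp
  have nat_mult: "(int n * fst v, int n * snd v) \<in> M" if "v \<in> M" for n v
  proof (induction n)
    case 0
    then show ?case using zero by (simp add: zero_prod_def)
  next
    case (Suc n)
    have "(int (Suc n) * fst v, int (Suc n) * snd v) = (int n * fst v, int n * snd v) + v"
      by (cases v) (simp add: algebra_simps)
    then show ?case using add[OF Suc that] by simp
  qed
  have int_mult: "(k * fst v, k * snd v) \<in> M" if "v \<in> M" for k v
  proof (cases k rule: int_cases2)
    case (nonneg n)
    then show ?thesis using nat_mult[OF that] by simp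
  next
    case (nonpos n)
    then show ?thesis using neg[OF nat_mult[OF that, of n]] by simp
  qed
  have "lin_comb p q w = (fst w * fst p, fst w * snd p) + (snd w * fst q, snd w * snd q)"
    by (simp add: lin_comb_def)
  then show ?thesis using add int_mult assms(2,3) by metis
qed

text \<open>Pigeonhole: there are finitely many cosets, so two different natural multiples of
  \<open>v\<close> share one, and their difference is the multiple sought.\<close>

lemma sublattice_multiple_mem:
  assumes M: "sublattice M" and fin: "finite (UNIV // {(v, w). v - w \<in> M})"
  obtains n :: int where "n > 0" "(n * fst v, n * snd v) \<in> M"
proof -
  let ?R = "{(v, w). v - w \<in> M}"
  let ?f = "\<lambda>i::nat. ?R `` {(int i * fst v, int i * snd v)}"
  have "range ?f \<subseteq> UNIV // ?R" by (intro image_subsetI quotientI) simp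
  then have "finite (range ?f)" using fin by (rule finite_subset)
  then have "\<not> inj ?f" using finite_imageD[of ?f UNIV] by auto
  then obtain i0 j0 where "i0 \<noteq> j0" "?f i0 = ?f j0" unfolding inj_def by blast
  then obtain i j where ij: "i < j" "?f i = ?f j"
    by (cases "i0 < j0") (auto simp: not_less_iff_gr_or_eq)
  have "(int j * fst v, int j * snd v) \<in> ?f j"
    using M by (auto simp: sublattice_def zero_prod_def)
  then have "(int j * fst v, int j * snd v) \<in> ?f i" using ij by simp
  then have mem: "(int i * fst v - int j * fst v, int i * snd v - int j * snd v) \<in> M" by simp
  have "lin_comb (int i * fst v - int j * fst v, int i * snd v - int j * snd v) 0 (-1, 0) \<in> M"
    using M by (intro sublattice_lin_comb mem) (auto simp: sublattice_def)
  then have "((int j - int i) * fst v, (int j - int i) * snd v) \<in> M"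
    by (simp add: lin_comb_def algebra_simps)
  then show ?thesis using ij that[of "int j - int i"] by simp
qed

lemma least_pos_int:
  assumes "\<exists>n::int. n > 0 \<and> P n"
  obtains n :: int where "n > 0" "P n" "\<And>k. k > 0 \<Longrightarrow> P k \<Longrightarrow> n \<le> k"
proof -
  define m where "m = (LEAST k::nat. k > 0 \<and> P (int k))"
  have ex: "\<exists>k::nat. k > 0 \<and> P (int k)" using assms by (metis pos_int_cases)
  have "m > 0 \<and> P (int m)" unfolding m_def using ex by (rule LeastI_ex)
  moreover have "int m \<le> k" if "k > 0" "P k" for k
  proof -
    have "m \<le> nat k" unfolding m_def using that by (intro Least_le) auto
    then show ?thesis using that by simp
  qed
  ultimately show ?thesis using that[of "int m"] by auto
qed

text \<open>Hermite normal form: \<open>(g, 0)\<close> and \<open>(m, n)\<close> generate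
  \<open>M\<close>, where \<open>g\<close> is the least positive entry on the first axis and
  \<open>n\<close> the least positive second coordinate. In the criterion \<open>y div n\<close>
  counts the copies of \<open>(m, n)\<close>.\<close>

lemma sublattice_triangular_form:
  assumes M: "sublattice M" and pos: "lattice_index M > 0"
  obtains g n m :: int where "g > 0" "n > 0" "int (lattice_index M) = g * n"
    "\<And>x y. (x, y) \<in> M \<longleftrightarrow> n dvd y \<and> g dvd x - m * (y div n)"
proof -
  let ?R = "{(v, w). v - w \<in> M}"
  have fin: "finite (UNIV // ?R)"
    using pos unfolding lattice_index_def by (metis card_gt_0_iff)
  have comb: "(s * x + t * x', s * y + t * y') \<in> M"
    if "(x, y) \<in> M" "(x', y') \<in> M" for s t x y x' y'
    using sublattice_lin_comb[OF M that, of "(s, t)"] by (simp add: lin_comb_def)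
  have "\<exists>n>0. (n, 0) \<in> M"
    by (rule sublattice_multiple_mem[OF M fin, of "(1, 0)"]) auto
  then obtain g where g: "g > 0" "(g, 0) \<in> M" "\<And>k. k > 0 \<Longrightarrow> (k, 0) \<in> M \<Longrightarrow> g \<le> k"
    by (rule least_pos_int) blast
  have "\<exists>n>0. (0, n) \<in> M"
    by (rule sublattice_multiple_mem[OF M fin, of "(0, 1)"]) auto
  then have "\<exists>n>0. \<exists>x. (x, n) \<in> M" by auto
  then obtain n where n: "n > 0" "\<exists>x. (x, n) \<in> M" "\<And>k. k > 0 \<Longrightarrow> \<exists>x. (x, k) \<in> M \<Longrightarrow> n \<le> k"
    by (rule least_pos_int) blast
  then obtain m where m: "(m, n) \<in> M" by auto
  have g_dvd: "g dvd x" if "(x, 0) \<in> M" for x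
  proof -
    have "(1 * x + (- (x div g)) * g, 1 * 0 + (- (x div g)) * 0) \<in> M"
      by (rule comb[OF that g(2)])
    then have "(x mod g, 0) \<in> M" by (simp add: minus_div_mult_eq_mod)
    moreover have "x mod g \<ge> 0" "x mod g < g" using g(1) by auto
    ultimately have "x mod g = 0" using g(3)[of "x mod g"] by linarith
    then show ?thesis by auto
  qed
  have n_dvd: "n dvd y" if "(x, y) \<in> M" for x y
  proof -
    have "(1 * x + (- (y div n)) * m, 1 * y + (- (y div n)) * n) \<in> M"
      by (rule comb[OF that m])
    then have "\<exists>x. (x, y mod n) \<in> M" by (auto simp: minus_div_mult_eq_mod)
    moreover have "y mod n \<ge> 0" "y mod n < n" using n(1) by auto
    ultimately have "y mod n = 0" using n(3)[of "y mod n"] by (metis less_le not_le)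
    then show ?thesis by auto
  qed
  have char: "(x, y) \<in> M \<longleftrightarrow> n dvd y \<and> g dvd x - m * (y div n)" for x y
  proof
    assume xy: "(x, y) \<in> M"
    have dv: "n dvd y" by (rule n_dvd[OF xy])
    have "(1 * x + (- (y div n)) * m, 1 * y + (- (y div n)) * n) \<in> M"
      by (rule comb[OF xy m])
    then have "(x - m * (y div n), 0) \<in> M" using dv by (simp add: mult.commute)
    then show "n dvd y \<and> g dvd x - m * (y div n)" using dv g_dvd by auto
  next
    assume *: "n dvd y \<and> g dvd x - m * (y div n)"
    then obtain k where k: "x - m * (y div n) = g * k" by auto
    have "(k * g + (y div n) * m, k * 0 + (y div n) * n) \<in> M" by (rule comb[OF g(2) m])
    moreover have "k * g + (y div n) * m = x" using k by (simp add: algebra_simps)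
    moreover have "k * 0 + (y div n) * n = y" using * by simp
    ultimately show "(x, y) \<in> M" by simp
  qed
  have equiv: "equiv UNIV ?R"
  proof (rule equivI)
    show "refl ?R" using M by (auto simp: refl_on_def sublattice_def)
    show "sym ?R"
    proof (rule symI, clarsimp)
      fix x y x' y' assume "(x - x', y - y') \<in> M"
      from comb[OF this this, of "-1" 0] show "(x' - x, y' - y) \<in> M" by simp
    qed
    show "trans ?R"
    proof (rule transI, clarsimp)
      fix x y x' y' x'' y'' assume "(x - x', y - y') \<in> M" "(x' - x'', y' - y'') \<in> M"
      from comb[OF this, of 1 1] show "(x - x'', y - y'') \<in> M" by simp
    qed
  qed simp
  \<comment> \<open>The box \<open>{0..<g} \<times> {0..<n}\<close> is a set of coset
    representatives, so the index is \<open>g * n\<close>.\<close>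
  have "bij_betw (\<lambda>v. ?R `` {v}) ({0..<g} \<times> {0..<n}) (UNIV // ?R)"
    unfolding bij_betw_def
  proof
    show "inj_on (\<lambda>v. ?R `` {v}) ({0..<g} \<times> {0..<n})"
    proof (rule inj_onI, clarify)
      fix i j i' j' :: int
      assume b: "i \<in> {0..<g}" "i' \<in> {0..<g}" "j \<in> {0..<n}" "j' \<in> {0..<n}"
      assume "?R `` {(i, j)} = ?R `` {(i', j')}"
      then have "((i, j), (i', j')) \<in> ?R" by (rule eq_equiv_class[OF _ equiv UNIV_I])
      then have mem: "(i - i', j - j') \<in> M" by simp
      have "n dvd j - j'" by (rule n_dvd[OF mem])
      then have j: "j = j'" using b dvd_imp_le_int[of "j - j'" n] by force
      then have "g dvd i - i'" using g_dvd mem by simp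
      then have "i = i'" using b dvd_imp_le_int[of "i - i'" g] by force
      then show "i = i' \<and> j = j'" using j by simp
    qed
    show "(\<lambda>v. ?R `` {v}) ` ({0..<g} \<times> {0..<n}) = UNIV // ?R"
    proof
      show "(\<lambda>v. ?R `` {v}) ` ({0..<g} \<times> {0..<n}) \<subseteq> UNIV // ?R"
        by (intro image_subsetI quotientI UNIV_I)
      show "UNIV // ?R \<subseteq> (\<lambda>v. ?R `` {v}) ` ({0..<g} \<times> {0..<n})"
      proof
        fix C assume "C \<in> UNIV // ?R"
        then obtain v where "C = ?R `` {v}" by (rule quotientE)
        then obtain x y where C: "C = ?R `` {(x, y)}" by (cases v) blast
        \<comment> \<open>Subtracting \<open>y div n\<close> copies of \<open>(m, n)\<close> reduces
          \<open>y\<close> but also shifts \<open>x\<close>, so the shift comes before the reduction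
          modulo \<open>g\<close>.\<close>
        define j i where "j = y mod n" and "i = (x - m * (y div n)) mod g"
        have 1: "y - j = n * (y div n)" by (simp add: j_def minus_mod_eq_mult_div)
        have "g dvd (x - m * (y div n)) - i" by (simp add: i_def)
        have "(y - j) div n = y div n" using 1 n(1) by simp
        then have "(x - i) - m * ((y - j) div n) = (x - m * (y div n)) - i" by simp
        then have "g dvd (x - i) - m * ((y - j) div n)"
          using \<open>g dvd (x - m * (y div n)) - i\<close> by (rule ssubst)
        moreover have "n dvd y - j" using 1 by simp
        ultimately have "(x - i, y - j) \<in> M" unfolding char by blast
        then have "((x, y), (i, j)) \<in> ?R" by simp
        then have "C = ?R `` {(i, j)}" unfolding C by (rule equiv_class_eq[OF equiv])
        moreover have "(i, j) \<in> {0..<g} \<times> {0..<n}" using g(1) n(1) by (simp add: i_def j_def)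
        ultimately show "C \<in> (\<lambda>v. ?R `` {v}) ` ({0..<g} \<times> {0..<n})" by blast
      qed
    qed
  qed
  from bij_betw_same_card[OF this] have "card (UNIV // ?R) = nat g * nat n"
    by (simp add: card_cartesian_product)
  then have "int (lattice_index M) = g * n" using g(1) n(1) by (simp add: lattice_index_def)
  then show ?thesis using that char g(1) n(1) by blast
qed

text \<open>A prime product \<open>g * n\<close> has a factor 1. It is not \<open>g\<close>, which
  would put \<open>(1, 0)\<close> in \<open>M\<close>; so \<open>n = 1\<close> and the triangular
  criterion becomes a single congruence.\<close>

lemma sublattice_prime_index:
  assumes M: "sublattice M" and l: "prime l" "lattice_index M = l" and e1: "(1, 0) \<notin> M"
  obtains m :: int where "\<And>x y. (x, y) \<in> M \<longleftrightarrow> int l dvd x - m * y"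
proof -
  from l have "lattice_index M > 0" by (simp add: prime_gt_0_nat)
  from sublattice_triangular_form[OF M this] obtain g n m where
    gn: "g > 0" "n > 0" "int (lattice_index M) = g * n"
    "\<And>x y. (x, y) \<in> M \<longleftrightarrow> n dvd y \<and> g dvd x - m * (y div n)" by blast
  have "g \<noteq> 1" using e1 gn by auto
  have "l = nat g * nat n" using gn(1-3) l(2) by (metis nat_int nat_mult_distrib order_less_le)
  with l(1) have "nat g = 1 \<or> nat n = 1" by (metis prime_product)
  then have "n = 1" using \<open>g \<noteq> 1\<close> gn(1) by auto
  then show ?thesis using that[of m] gn l(2) by simp
qed

section \<open>Minimal vectors\<close>

lemma rhombic_form_diagonal:
  fixes a b :: "'a::comm_ring_1"
  shows "4 * (a * x\<^sup>2 + b * x * y + a * y\<^sup>2) = (2 * a + b) * (x + y)\<^sup>2 + (2 * a - b) * (x - y)\<^sup>2"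
  by (simp add: power2_eq_square algebra_simps)

text \<open>Gram determinants: passing to the vectors \<open>p\<close>, \<open>q\<close> multiplies
  the discriminant by the square of their determinant.\<close>

lemma restricted_discriminant:
  fixes a b c p1 p2 q1 q2 :: "'a::comm_ring_1"
  shows "4 * (a * p1\<^sup>2 + b * p1 * p2 + c * p2\<^sup>2) * (a * q1\<^sup>2 + b * q1 * q2 + c * q2\<^sup>2)
      - (2 * a * p1 * q1 + b * (p1 * q2 + p2 * q1) + 2 * c * p2 * q2)\<^sup>2
    = (p1 * q2 - p2 * q1)\<^sup>2 * (4 * a * c - b\<^sup>2)"
  by (simp add: power2_eq_square algebra_simps)

text \<open>Bounding the cross term by \<open>a |x y|\<close> leaves
  \<open>a (x^2 - |x y| + y^2) + (c - a) y^2\<close>, and for \<open>y \<noteq> 0\<close> the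
  bracket and \<open>y^2\<close> are both at least 1.\<close>

lemma reduced_form_ge:
  fixes a b c x y :: int
  assumes "\<bar>b\<bar> \<le> a" "a \<le> c" "(x, y) \<noteq> (0, 0)"
  shows "a \<le> a * x\<^sup>2 + b * x * y + c * y\<^sup>2"
    and "y \<noteq> 0 \<Longrightarrow> c \<le> a * x\<^sup>2 + b * x * y + c * y\<^sup>2"
proof -
  have "\<bar>b * x * y\<bar> \<le> a * (\<bar>x\<bar> * \<bar>y\<bar>)"
    using assms(1) by (simp add: abs_mult mult_right_mono mult.assoc)
  then have lower: "a * (\<bar>x\<bar> * \<bar>x\<bar> - \<bar>x\<bar> * \<bar>y\<bar>) + c * (\<bar>y\<bar> * \<bar>y\<bar>) \<le> a * x\<^sup>2 + b * x * y + c * y\<^sup>2"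
    by (simp add: power2_eq_square right_diff_distrib)
  show c_le: "c \<le> a * x\<^sup>2 + b * x * y + c * y\<^sup>2" if "y \<noteq> 0"
  proof -
    define X Y where "X = \<bar>x\<bar>" and "Y = \<bar>y\<bar>"
    have XY: "X \<ge> 0" "Y \<ge> 1" using that by (auto simp: X_def Y_def)
    have a0: "a \<ge> 0" using assms by linarith
    have YY: "Y * Y \<ge> 1" using mult_mono[of 1 Y 1 Y] XY by simp
    have "X * X - X * Y + Y * Y \<ge> 1"
    proof (cases "X \<ge> Y")
      case True
      then have "X * (X - Y) \<ge> 0" using XY by simp
      then show ?thesis using YY by (simp add: algebra_simps)
    next
      case False
      then have "1 * 1 \<le> (Y - X) * Y" using XY by (intro mult_mono) auto
      moreover have "X * X \<ge> 0" by simp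
      ultimately show ?thesis unfolding left_diff_distrib by linarith
    qed
    then have "a * (X * X - X * Y + Y * Y) \<ge> a * 1" using a0 by (intro mult_left_mono) auto
    moreover have "(c - a) * (Y * Y) \<ge> (c - a) * 1"
      using assms YY by (intro mult_left_mono) auto
    ultimately show ?thesis using lower unfolding X_def[symmetric] Y_def[symmetric]
      by (simp add: algebra_simps)
  qed
  show "a \<le> a * x\<^sup>2 + b * x * y + c * y\<^sup>2"
  proof (cases "y = 0")
    case True
    then have "x\<^sup>2 \<ge> 1" using assms(3) by (simp add: int_one_le_iff_zero_less)
    then have "a * 1 \<le> a * x\<^sup>2" using assms(1) by (intro mult_left_mono) auto
    then show ?thesis using True by simp
  next
    case False
    then show ?thesis using c_le assms(2) by linarith
  qed
qed

lemma rounded_division: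
  fixes n d :: int
  assumes "d \<noteq> 0"
  obtains k where "2 * \<bar>n - d * k\<bar> \<le> \<bar>d\<bar>"
proof -
  define e where "e = \<bar>d\<bar>"
  have e: "e > 0" using assms by (simp add: e_def)
  \<comment> \<open>Adding \<open>e\<close> before dividing \<open>2 * n\<close> by
    \<open>2 * e\<close> rounds to the nearest integer; the sign of \<open>d\<close> is moved into
    the quotient afterwards.\<close>
  define k where "k = (2 * n + e) div (2 * e)"
  have "2 * n + e = 2 * e * k + (2 * n + e) mod (2 * e)" by (simp add: k_def)
  moreover have "0 \<le> (2 * n + e) mod (2 * e)" "(2 * n + e) mod (2 * e) < 2 * e" using e by auto
  ultimately have "2 * \<bar>n - e * k\<bar> \<le> e" by (simp add: abs_if)
  moreover have "e * k = d * (sgn d * k)" unfolding e_def by (metis abs_sgn mult.assoc)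
  ultimately show ?thesis using that[of "sgn d * k"] unfolding e_def by metis
qed

text \<open>A vector reduced modulo \<open>p\<close> and \<open>q\<close> has coordinates of absolute value at most \<open>1/2\<close>, so its
  value is at most \<open>3/4\<close> of the minimum.\<close>

lemma minimal_vectors_generate:
  fixes a b c u v p1 p2 q1 q2 :: int
  assumes M: "sublattice M" and mem: "(p1, p2) \<in> M" "(q1, q2) \<in> M"
    and u: "u > 0"
    and up: "u = a * p1\<^sup>2 + b * p1 * p2 + c * p2\<^sup>2"
    and uq: "u = a * q1\<^sup>2 + b * q1 * q2 + c * q2\<^sup>2"
    and v: "v = 2 * a * p1 * q1 + b * (p1 * q2 + p2 * q1) + 2 * c * p2 * q2"
    and det: "p1 * q2 - p2 * q1 \<noteq> 0"
    and min: "\<And>x y. (x, y) \<in> M \<Longrightarrow> (x, y) \<noteq> (0, 0) \<Longrightarrow> u \<le> a * x\<^sup>2 + b * x * y + c * y\<^sup>2"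
  shows "\<bar>v\<bar> \<le> u"
    and "\<And>w. w \<in> M \<Longrightarrow> \<exists>z. w = lin_comb (p1, p2) (q1, q2) z"
proof -
  have comb: "(s * p1 + t * q1, s * p2 + t * q2) \<in> M" for s t
    using sublattice_lin_comb[OF M mem, of "(s, t)"] by (simp add: lin_comb_def)
  have form: "a * (s * p1 + t * q1)\<^sup>2 + b * (s * p1 + t * q1) * (s * p2 + t * q2)
      + c * (s * p2 + t * q2)\<^sup>2 = u * s\<^sup>2 + v * s * t + u * t\<^sup>2" for s t
  proof -
    have "a * (s * p1 + t * q1)\<^sup>2 + b * (s * p1 + t * q1) * (s * p2 + t * q2)
      + c * (s * p2 + t * q2)\<^sup>2 = (a * p1\<^sup>2 + b * p1 * p2 + c * p2\<^sup>2) * s\<^sup>2 + v * s * t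
        + (a * q1\<^sup>2 + b * q1 * q2 + c * q2\<^sup>2) * t\<^sup>2"
      unfolding v by (simp add: power2_eq_square algebra_simps)
    then show ?thesis using up uq by simp
  qed
  have "u \<le> u * s\<^sup>2 + v * s * t + u * t\<^sup>2" if "s * t \<noteq> 0" for s t
  proof -
    have "(s * p1 + t * q1, s * p2 + t * q2) \<noteq> (0, 0)"
    proof
      assume "(s * p1 + t * q1, s * p2 + t * q2) = (0, 0)"
      then have "(s * p1 + t * q1) * q2 - (s * p2 + t * q2) * q1 = 0" by simp
      then have "s * (p1 * q2 - p2 * q1) = 0" by (simp add: algebra_simps)
      then show False using det that by simp
    qed
    from min[OF comb this] show ?thesis by (simp add: form)
  qed
  \<comment> \<open>The vectors \<open>p + q\<close> and \<open>p - q\<close> have values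
    \<open>2 u + v\<close> and \<open>2 u - v\<close>, each at least \<open>u\<close>.\<close>
  from this[of 1 1] this[of 1 "-1"] show v_le: "\<bar>v\<bar> \<le> u" by simp
  fix w assume "w \<in> M"
  obtain x y where w: "w = (x, y)" by (cases w)
  define d where "d = p1 * q2 - p2 * q1"
  have d: "d \<noteq> 0" using det d_def by simp
  \<comment> \<open>By Cramer's rule the two numerators over \<open>d\<close> are the coordinates of
    \<open>w\<close>; \<open>i\<close> and \<open>j\<close> are nearest integers to them, and
    \<open>r / d\<close>, \<open>s / d\<close> the remainders.\<close>
  obtain i where i: "2 * \<bar>(x * q2 - y * q1) - d * i\<bar> \<le> \<bar>d\<bar>" using rounded_division[OF d] .
  obtain j where j: "2 * \<bar>(p1 * y - p2 * x) - d * j\<bar> \<le> \<bar>d\<bar>" using rounded_division[OF d] .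
  define r s where "r = (x * q2 - y * q1) - d * i" and "s = (p1 * y - p2 * x) - d * j"
  define x' y' where "x' = x - (i * p1 + j * q1)" and "y' = y - (i * p2 + j * q2)"
  have x'y': "(x', y') \<in> M"
    using M comb[of i j] \<open>w \<in> M\<close> unfolding sublattice_def w x'_def y'_def
    by (metis diff_Pair)
  have dx: "d * x' = r * p1 + s * q1" "d * y' = r * p2 + s * q2"
    by (simp_all add: d_def x'_def y'_def r_def s_def algebra_simps)
  have "d\<^sup>2 * (a * x'\<^sup>2 + b * x' * y' + c * y'\<^sup>2)
      = a * (d * x')\<^sup>2 + b * (d * x') * (d * y') + c * (d * y')\<^sup>2"
    by (simp add: power2_eq_square algebra_simps)
  also have "\<dots> = u * r\<^sup>2 + v * r * s + u * s\<^sup>2"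
    unfolding dx form ..
  finally have eq: "d\<^sup>2 * (a * x'\<^sup>2 + b * x' * y' + c * y'\<^sup>2) = u * r\<^sup>2 + v * r * s + u * s\<^sup>2" .
  have sq: "4 * (\<bar>m\<bar> * \<bar>n\<bar>) \<le> d\<^sup>2" if "2 * \<bar>m\<bar> \<le> \<bar>d\<bar>" "2 * \<bar>n\<bar> \<le> \<bar>d\<bar>" for m n
  proof -
    have "(2 * \<bar>m\<bar>) * (2 * \<bar>n\<bar>) \<le> \<bar>d\<bar> * \<bar>d\<bar>" using that by (intro mult_mono) auto
    then show ?thesis by (simp add: power2_eq_square)
  qed
  have rs: "4 * r\<^sup>2 \<le> d\<^sup>2" "4 * s\<^sup>2 \<le> d\<^sup>2" "4 * \<bar>r * s\<bar> \<le> d\<^sup>2"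
    using sq[of r r] sq[of s s] sq[of r s] i j
    by (simp_all add: r_def s_def abs_mult power2_eq_square)
  have "\<bar>v * (r * s)\<bar> \<le> u * \<bar>r * s\<bar>"
    using v_le by (simp add: abs_mult mult_right_mono)
  then have "4 * (u * r\<^sup>2 + v * r * s + u * s\<^sup>2) \<le> u * (4 * r\<^sup>2) + u * (4 * \<bar>r * s\<bar>) + u * (4 * s\<^sup>2)"
    by (simp add: algebra_simps)
  also have "\<dots> \<le> u * d\<^sup>2 + u * d\<^sup>2 + u * d\<^sup>2"
    using u rs by (intro add_mono mult_left_mono) auto
  finally have "4 * (d\<^sup>2 * (a * x'\<^sup>2 + b * x' * y' + c * y'\<^sup>2)) \<le> 3 * (d\<^sup>2 * u)"
    unfolding eq by (simp add: algebra_simps)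
  moreover have "d\<^sup>2 * u > 0" using d u by simp
  ultimately have "d\<^sup>2 * (a * x'\<^sup>2 + b * x' * y' + c * y'\<^sup>2) < d\<^sup>2 * u" by linarith
  then have "a * x'\<^sup>2 + b * x' * y' + c * y'\<^sup>2 < u" by (simp add: mult_less_cancel_left)
  then have "(x', y') = (0, 0)" using min[OF x'y'] by linarith
  then have "w = lin_comb (p1, p2) (q1, q2) (i, j)"
    by (simp add: w lin_comb_def x'_def y'_def)
  then show "\<exists>z. w = lin_comb (p1, p2) (q1, q2) z" ..
qed

text \<open>Collinearity gives \<open>p1 q = q1 p\<close> as vectors. Taking values yields
  \<open>p1^2 u = q1^2 u\<close>, likewise for the second coordinates, and the vanishing determinant
  matches the signs.\<close>

lemma equal_value_collinear:
  fixes a b c u p1 p2 q1 q2 :: int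
  assumes "u \<noteq> 0"
    and up: "u = a * p1\<^sup>2 + b * p1 * p2 + c * p2\<^sup>2"
    and uq: "u = a * q1\<^sup>2 + b * q1 * q2 + c * q2\<^sup>2"
    and det: "p1 * q2 - p2 * q1 = 0"
  shows "(q1, q2) = (p1, p2) \<or> (q1, q2) = (- p1, - p2)"
proof -
  have d: "p1 * q2 = p2 * q1" using det by simp
  have "p1\<^sup>2 * u = a * (p1 * q1)\<^sup>2 + b * (p1 * q1) * (p1 * q2) + c * (p1 * q2)\<^sup>2"
    by (subst uq) (simp add: power2_eq_square algebra_simps)
  also have "\<dots> = q1\<^sup>2 * u" unfolding d by (subst up) (simp add: power2_eq_square algebra_simps)
  finally have 1: "p1\<^sup>2 = q1\<^sup>2" using assms(1) by simp
  have "p2\<^sup>2 * u = a * (p2 * q1)\<^sup>2 + b * (p2 * q1) * (p2 * q2) + c * (p2 * q2)\<^sup>2"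
    by (subst uq) (simp add: power2_eq_square algebra_simps)
  also have "\<dots> = q2\<^sup>2 * u" unfolding d[symmetric] by (subst up) (simp add: power2_eq_square algebra_simps)
  finally have 2: "p2\<^sup>2 = q2\<^sup>2" using assms(1) by simp
  from 1 2 d show ?thesis by (auto simp: power2_eq_iff)
qed

section \<open>The content of the restricted form\<close>

text \<open>The threshold 12 is the bound reached below both when \<open>(1, -1)\<close> lies in the
  sublattice and when a short vector is divisible by \<open>l\<close>.\<close>

lemma small_square_cases:
  fixes l :: int
  assumes "prime l" "l\<^sup>2 \<le> 12"
  shows "l = 2 \<or> l = 3"
proof -
  have "l < 4" using power2_less_imp_less[of l 4] assms(2) by simp
  then show ?thesis using prime_ge_2_int[OF assms(1)] by linarith
qed

text \<open>The sublattice enters through the congruence \<open>l dvd x - m * y\<close>; that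
  \<open>l\<close> does not divide \<open>m\<close> says that \<open>(0, 1)\<close> is outside. Its
  minimal vectors \<open>p\<close>, \<open>q\<close> are ordered and signed so that the determinant
  is \<open>l\<close> and \<open>v \<le> 0\<close>.\<close>

locale rhombic_sublattice =
  fixes a b l u v m p1 p2 q1 q2 :: int
  assumes l: "prime l" and b_bounds: "- a \<le> b" "b \<le> 0" and a_pos: "a > 0" and cop: "gcd a b = 1"
    and up: "u = a * p1\<^sup>2 + b * p1 * p2 + a * p2\<^sup>2"
    and uq: "u = a * q1\<^sup>2 + b * q1 * q2 + a * q2\<^sup>2"
    and v: "v = 2 * a * p1 * q1 + b * (p1 * q2 + p2 * q1) + 2 * a * p2 * q2"
    and det: "p1 * q2 - p2 * q1 = l"
    and v_bounds: "- u \<le> v" "v \<le> 0"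
    and mem: "l dvd p1 - m * p2" "l dvd q1 - m * q2" and m: "\<not> l dvd m"
    and min: "\<And>x y. (x, y) \<noteq> (0, 0) \<Longrightarrow> l dvd x - m * y \<Longrightarrow> u \<le> a * x\<^sup>2 + b * x * y + a * y\<^sup>2"
begin

text \<open>The vectors \<open>(1, 1)\<close> and \<open>(1, -1)\<close> are orthogonal, with values \<open>P\<close> and \<open>N\<close>. Twice the coordinates of
  \<open>p + q\<close> in this basis are \<open>X\<close>, \<open>Y\<close>, and those of \<open>p - q\<close> are \<open>Z\<close>, \<open>W\<close>.\<close>

definition P where "P = 2 * a + b"
definition N where "N = 2 * a - b"
definition X where "X = p1 + p2 + q1 + q2"
definition Y where "Y = p1 - p2 + q1 - q2"
definition Z where "Z = p1 + p2 - q1 - q2"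
definition W where "W = p1 - p2 - q1 + q2"

lemma l_ge_2: "l \<ge> 2" by (rule prime_ge_2_int[OF l])

lemma PN_bounds: "a \<le> P" "P \<le> 2 * a" "2 * a \<le> N" "N \<le> 3 * a" "P > 0" "N > 0"
  using b_bounds a_pos by (auto simp: P_def N_def)

lemma discr_eq: "4 * u\<^sup>2 - v\<^sup>2 = l\<^sup>2 * (P * N)"
proof -
  have "4 * u * u - v\<^sup>2 = l\<^sup>2 * (4 * a * a - b\<^sup>2)"
    using restricted_discriminant[of a p1 b p2 a q1 q2] unfolding up[symmetric] uq[symmetric] v[symmetric] det .
  then show ?thesis by (simp add: P_def N_def power2_eq_square algebra_simps)
qed

lemma four_u_squared_ge: "l\<^sup>2 * (P * N) \<le> 4 * u\<^sup>2"
  using discr_eq zero_le_power2[of v] by linarith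

lemma three_u_squared_le: "3 * u\<^sup>2 \<le> l\<^sup>2 * (P * N)"
proof -
  have "v\<^sup>2 \<le> u\<^sup>2" using v_bounds by (intro abs_le_square_iff[THEN iffD1]) auto
  then show ?thesis using discr_eq by linarith
qed

lemma u_ge: "u \<ge> a"
proof -
  have "(p1, p2) \<noteq> (0, 0)" using det l_ge_2 by auto
  from reduced_form_ge(1)[OF _ _ this, of b a a] show ?thesis using b_bounds up a_pos by simp
qed

text \<open>Equal values of \<open>p\<close> and \<open>q\<close> make \<open>p + q\<close> and
  \<open>p - q\<close> orthogonal, which reads \<open>X Z P + Y W N = 0\<close>; the determinant
  gives \<open>X W - Y Z = 4 l\<close>. Combining both with the diagonal expressions for
  \<open>2 u + v\<close> and \<open>2 u - v\<close> leaves relations that display the factor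
  \<open>l\<close>.\<close>

lemma sum_diff_values:
  "W * (2 * u + v) = l * X * P" "Z * (2 * u + v) = - (l * Y * N)"
  "X * (2 * u - v) = l * W * N" "Y * (2 * u - v) = - (l * Z * P)"
proof -
  have cancel: "x = y" if "4 * x = 4 * y" for x y :: int using that by simp
  have orth: "X * Z * P = - (Y * W * N)"
  proof -
    have "X * Z * P + Y * W * N = 4 * (a * p1\<^sup>2 + b * p1 * p2 + a * p2\<^sup>2) - 4 * (a * q1\<^sup>2 + b * q1 * q2 + a * q2\<^sup>2)"
      by (simp add: X_def Y_def Z_def W_def P_def N_def power2_eq_square algebra_simps)
    then show ?thesis using up uq by simp
  qed
  have XWYZ: "X * W - Y * Z = 4 * l"
    by (simp add: det[symmetric] X_def Y_def Z_def W_def algebra_simps)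
  have s: "4 * (2 * u + v) = X\<^sup>2 * P + Y\<^sup>2 * N"
  proof -
    have "X\<^sup>2 * P + Y\<^sup>2 * N = 4 * ((a * p1\<^sup>2 + b * p1 * p2 + a * p2\<^sup>2) + (a * q1\<^sup>2 + b * q1 * q2 + a * q2\<^sup>2) + v)"
      by (simp add: v X_def Y_def P_def N_def power2_eq_square algebra_simps)
    then show ?thesis unfolding up[symmetric] uq[symmetric] by simp
  qed
  have d: "4 * (2 * u - v) = Z\<^sup>2 * P + W\<^sup>2 * N"
  proof -
    have "Z\<^sup>2 * P + W\<^sup>2 * N = 4 * ((a * p1\<^sup>2 + b * p1 * p2 + a * p2\<^sup>2) + (a * q1\<^sup>2 + b * q1 * q2 + a * q2\<^sup>2) - v)"
      by (simp add: v Z_def W_def P_def N_def power2_eq_square algebra_simps)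
    then show ?thesis unfolding up[symmetric] uq[symmetric] by simp
  qed
  have "4 * (W * (2 * u + v)) = W * (4 * (2 * u + v))" by simp
  also have "\<dots> = X * P * (X * W) + Y * (Y * W * N)"
    unfolding s by (simp add: power2_eq_square algebra_simps)
  also have "\<dots> = X * P * (X * W) + Y * - (X * Z * P)" unfolding orth by simp
  also have "\<dots> = X * P * (X * W - Y * Z)" by (simp add: algebra_simps)
  finally have "4 * (W * (2 * u + v)) = 4 * (l * X * P)"
    unfolding XWYZ by (simp only: mult_ac mult_minus_left mult_minus_right)
  then show "W * (2 * u + v) = l * X * P" by (rule cancel)
  have "4 * (Z * (2 * u + v)) = Z * (4 * (2 * u + v))" by simp
  also have "\<dots> = X * (X * Z * P) + Y * N * (Y * Z)"
    unfolding s by (simp add: power2_eq_square algebra_simps)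
  also have "\<dots> = X * - (Y * W * N) + Y * N * (Y * Z)" unfolding orth ..
  also have "\<dots> = - (Y * N * (X * W - Y * Z))" by (simp add: algebra_simps)
  finally have "4 * (Z * (2 * u + v)) = 4 * (- (l * Y * N))"
    unfolding XWYZ by (simp only: mult_ac mult_minus_left mult_minus_right)
  then show "Z * (2 * u + v) = - (l * Y * N)" by (rule cancel)
  have "4 * (X * (2 * u - v)) = X * (4 * (2 * u - v))" by simp
  also have "\<dots> = Z * (X * Z * P) + W * N * (X * W)"
    unfolding d by (simp add: power2_eq_square algebra_simps)
  also have "\<dots> = Z * - (Y * W * N) + W * N * (X * W)" unfolding orth ..
  also have "\<dots> = W * N * (X * W - Y * Z)" by (simp add: algebra_simps)
  finally have "4 * (X * (2 * u - v)) = 4 * (l * W * N)"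
    unfolding XWYZ by (simp only: mult_ac mult_minus_left mult_minus_right)
  then show "X * (2 * u - v) = l * W * N" by (rule cancel)
  have "4 * (Y * (2 * u - v)) = Y * (4 * (2 * u - v))" by simp
  also have "\<dots> = Z * P * (Y * Z) + W * (Y * W * N)"
    unfolding d by (simp add: power2_eq_square algebra_simps)
  also have "\<dots> = Z * P * (Y * Z) + W * - (X * Z * P)" unfolding orth by simp
  also have "\<dots> = - (Z * P * (X * W - Y * Z))" by (simp add: algebra_simps)
  finally have "4 * (Y * (2 * u - v)) = 4 * (- (l * Z * P))"
    unfolding XWYZ by (simp only: mult_ac mult_minus_left mult_minus_right)
  then show "Y * (2 * u - v) = - (l * Z * P)" by (rule cancel)
qed

text \<open>The hypothesis puts \<open>(1, 1)\<close>, of value \<open>P\<close>, in the sublattice,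
  which bounds its minimum \<open>u\<close>; the lower bound on \<open>u^2\<close> from the
  discriminant then gives the second claim after cancelling \<open>P\<close>.\<close>

lemma diagonal_mem_bound:
  assumes "l dvd 1 - m"
  shows "u \<le> P" "l\<^sup>2 * N \<le> 4 * P"
proof -
  show u: "u \<le> P" using min[of 1 1] assms by (simp add: P_def)
  have "u\<^sup>2 \<le> P\<^sup>2" using u u_ge a_pos by (intro power_mono) auto
  then have "l\<^sup>2 * (P * N) \<le> 4 * P\<^sup>2" using four_u_squared_ge by linarith
  then have "P * (l\<^sup>2 * N) \<le> P * (4 * P)" by (simp only: power2_eq_square mult_ac)
  then show "l\<^sup>2 * N \<le> 4 * P" using PN_bounds by (simp only: mult_le_cancel_left_pos)
qed

text \<open>The same comparison for \<open>(1, -1)\<close>, whose value is \<open>N\<close>.\<close>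

lemma antidiagonal_mem_bound:
  assumes "l dvd 1 + m"
  shows "u \<le> N" "l\<^sup>2 * P \<le> 4 * N"
proof -
  show u: "u \<le> N" using min[of 1 "-1"] assms by (simp add: N_def)
  have "u\<^sup>2 \<le> N\<^sup>2" using u u_ge a_pos by (intro power_mono) auto
  then have "l\<^sup>2 * (P * N) \<le> 4 * N\<^sup>2" using four_u_squared_ge by linarith
  then have "N * (l\<^sup>2 * P) \<le> N * (4 * N)" by (simp only: power2_eq_square mult_ac)
  then show "l\<^sup>2 * P \<le> 4 * N" using PN_bounds by (simp only: mult_le_cancel_left_pos)
qed

lemma diagonal_mem_le_2:
  assumes "l dvd 1 - m"
  shows "l = 2" "b = 0"
proof -
  have "l\<^sup>2 * N \<le> 4 * P" by (rule diagonal_mem_bound(2)[OF assms])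
  also have "\<dots> \<le> 4 * N" using PN_bounds by linarith
  finally have "N * l\<^sup>2 \<le> N * 4" by (simp only: mult.commute)
  then have l4: "l\<^sup>2 \<le> 4" using PN_bounds by (simp only: mult_le_cancel_left_pos)
  then show l2: "l = 2" using power2_le_imp_le[of l 2] l_ge_2 by simp
  \<comment> \<open>For \<open>l = 2\<close> the bound says \<open>N \<le> P\<close>, that is
    \<open>b \<ge> 0\<close>.\<close>
  then show "b = 0" using diagonal_mem_bound(2)[OF assms] b_bounds by (simp add: P_def N_def)
qed

text \<open>Here \<open>P \<ge> a\<close> and \<open>N \<le> 3 a\<close>, which turns the bound into
  \<open>l^2 \<le> 12\<close>.\<close>

lemma antidiagonal_mem_le_3:
  assumes "l dvd 1 + m"
  shows "l = 2 \<or> l = 3"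
proof -
  have "l\<^sup>2 * a \<le> l\<^sup>2 * P" using PN_bounds by (intro mult_left_mono) auto
  also have "\<dots> \<le> 4 * N" by (rule antidiagonal_mem_bound(2)[OF assms])
  also have "\<dots> \<le> 12 * a" using PN_bounds by linarith
  finally have "a * l\<^sup>2 \<le> a * 12" by (simp only: mult.commute)
  then have "l\<^sup>2 \<le> 12" using a_pos by (simp only: mult_le_cancel_left_pos)
  then show ?thesis using small_square_cases[OF l] by simp
qed

text \<open>Since \<open>m\<close> is odd, \<open>(1, 1)\<close> lies in the sublattice; this forces
  the form \<open>x^2 + y^2\<close> and \<open>u \<le> 2\<close>, and the discriminant excludes
  \<open>u = 1\<close>.\<close>

lemma index_two:
  assumes "l = 2"
  shows "u = 2 \<and> v = 0"
proof -
  have "l dvd 1 - m" using m assms by simp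
  from diagonal_mem_le_2(2)[OF this] diagonal_mem_bound(1)[OF this] have b: "b = 0" and u: "u \<le> P" by auto
  then have "a = 1" using cop a_pos by simp
  then have PN: "P = 2" "N = 2" unfolding P_def N_def using b by simp_all
  have "4 * u\<^sup>2 - v\<^sup>2 = 16" and u2: "u \<le> 2" using discr_eq u assms by (simp_all add: PN)
  moreover have "u \<ge> 1" using u_ge a_pos by linarith
  then have "u = 1 \<or> u = 2" using u2 by linarith
  moreover have "4 * 1\<^sup>2 - v\<^sup>2 < 16" using zero_le_power2[of v] unfolding one_power2 by linarith
  ultimately have "u = 2" by auto
  with \<open>4 * u\<^sup>2 - v\<^sup>2 = 16\<close> show ?thesis by simp
qed

text \<open>The sublattice is \<open>3 dvd x + y\<close>, so off the antidiagonal
  \<open>(x + y)^2 \<ge> 9\<close>. Either \<open>(x - y)^2 \<ge> 1\<close> supplies the term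
  \<open>N\<close>, or \<open>x = y\<close> is a multiple of 3, whence
  \<open>(x + y)^2 \<ge> 36\<close> and \<open>N \<le> 3 P\<close> suffices.\<close>

lemma antidiagonal_vector:
  assumes "l = 3" "l dvd 1 + m" "l dvd x - m * y" "x + y \<noteq> 0"
  shows "9 * P + N \<le> 4 * (a * x\<^sup>2 + b * x * y + a * y\<^sup>2)"
proof -
  have "l dvd (x - m * y) + (1 + m) * y" using assms by simp
  then have xy: "3 dvd x + y" using assms(1) by (simp add: algebra_simps)
  then have "3 \<le> \<bar>x + y\<bar>" using dvd_imp_le_int[of "x + y" 3] assms(4) by simp
  then have x9: "9 \<le> (x + y)\<^sup>2" using power_mono[of 3 "\<bar>x + y\<bar>" 2] by simp
  show ?thesis unfolding rhombic_form_diagonal P_def[symmetric] N_def[symmetric]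
  proof (cases "x = y")
    case True
    then have "3 dvd x" using xy by presburger
    then obtain t where t: "x = 3 * t" by auto
    then have "t\<^sup>2 \<ge> 1" using True assms(4) by (simp add: int_one_le_iff_zero_less)
    moreover have "(x + y)\<^sup>2 = 36 * t\<^sup>2"
      unfolding True[symmetric] t by (simp add: power2_eq_square)
    ultimately have "(x + y)\<^sup>2 \<ge> 36" by linarith
    then have "P * 36 \<le> P * (x + y)\<^sup>2" using PN_bounds by (intro mult_left_mono) auto
    moreover have "N \<le> 3 * P" using PN_bounds by linarith
    moreover have "0 \<le> N * (x - y)\<^sup>2" using PN_bounds by simp
    ultimately show "9 * P + N \<le> P * (x + y)\<^sup>2 + N * (x - y)\<^sup>2" using PN_bounds by linarith
  next
    case False
    then have "1 \<le> (x - y)\<^sup>2" by (simp add: int_one_le_iff_zero_less)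
    then have "N * 1 \<le> N * (x - y)\<^sup>2" using PN_bounds by (intro mult_left_mono) auto
    moreover have "P * 9 \<le> P * (x + y)\<^sup>2" using PN_bounds x9 by (intro mult_left_mono) auto
    ultimately show "9 * P + N \<le> P * (x + y)\<^sup>2 + N * (x - y)\<^sup>2" by linarith
  qed
qed

text \<open>For index 3 only the hexagonal form survives: otherwise \<open>(1, -1)\<close> is, up to sign, the only
  minimal vector of the sublattice.\<close>

lemma index_three:
  assumes l3: "l = 3"
  shows "u = 3 \<and> v = - 3"
proof -
  have "l dvd 1 - m \<or> l dvd 1 + m" using m l3 by presburger
  then have anti: "l dvd 1 + m" using diagonal_mem_le_2(1) l3 by auto
  have uN: "u \<le> N" by (rule antidiagonal_mem_bound(1)[OF anti])
  \<comment> \<open>Two independent vectors cannot both lie on the antidiagonal.\<close>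
  have "p1 + p2 \<noteq> 0 \<or> q1 + q2 \<noteq> 0"
  proof (rule ccontr)
    assume "\<not> ?thesis"
    then have "p2 = - p1" "q2 = - q1" by auto
    then show False using det l_ge_2 by simp
  qed
  then have "9 * P + N \<le> 4 * u"
    using antidiagonal_vector[OF l3 anti mem(1)] antidiagonal_vector[OF l3 anti mem(2)] up uq by auto
  \<comment> \<open>Now \<open>9 P + N \<le> 4 N\<close>, so \<open>3 P \<le> N\<close>, which says
    \<open>a + b \<le> 0\<close>.\<close>
  then have "b = - a" using uN b_bounds by (simp add: P_def N_def)
  then have a: "a = 1" "b = -1" using cop a_pos by auto
  then have PN: "P = 1" "N = 3" unfolding P_def N_def by simp_all
  have u3: "u \<le> 3" and d: "4 * u\<^sup>2 - v\<^sup>2 = 27" using uN discr_eq l3 by (simp_all add: PN)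
  have "u = 3"
  proof (rule ccontr)
    assume "u \<noteq> 3"
    then have "u \<le> 2" "u \<ge> 1" using u3 u_ge a by auto
    then have "u\<^sup>2 \<le> 4" using power_mono[of u 2 2] by simp
    then show False using d zero_le_power2[of v] by linarith
  qed
  then have "v\<^sup>2 = 3\<^sup>2" using d by simp
  then have "v = 3 \<or> v = - 3" unfolding power2_eq_iff .
  then show ?thesis using \<open>u = 3\<close> v_bounds by auto
qed

text \<open>A non-zero vector of \<open>l Z^2\<close> has value at least \<open>l^2 a\<close>, while
  \<open>3 u^2 \<le> 4 a^2 l^2\<close>. The allowance \<open>3 u\<close> covers both
  \<open>p + q\<close> and \<open>p - q\<close>, as \<open>- u \<le> v \<le> 0\<close>.\<close>

lemma divisible_vector_bound:
  assumes "l dvd x" "l dvd y" "(x, y) \<noteq> (0, 0)" and le: "a * x\<^sup>2 + b * x * y + a * y\<^sup>2 \<le> 3 * u"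
  shows "l\<^sup>2 \<le> 12"
proof -
  obtain x' y' where xy: "x = l * x'" "y = l * y'" using assms(1,2) by (auto elim!: dvdE)
  then have "a \<le> a * x'\<^sup>2 + b * x' * y' + a * y'\<^sup>2"
    using reduced_form_ge(1)[of b a a x' y'] b_bounds a_pos assms(3) by auto
  then have "l\<^sup>2 * a \<le> l\<^sup>2 * (a * x'\<^sup>2 + b * x' * y' + a * y'\<^sup>2)" by (intro mult_left_mono) auto
  also have "\<dots> = a * x\<^sup>2 + b * x * y + a * y\<^sup>2" by (simp add: xy power2_eq_square algebra_simps)
  finally have la: "l\<^sup>2 * a \<le> 3 * u" using le by linarith
  moreover have "0 \<le> l\<^sup>2 * a" using a_pos by simp
  ultimately have "(l\<^sup>2 * a)\<^sup>2 \<le> (3 * u)\<^sup>2" by (intro power_mono)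
  also have "\<dots> = 3 * (3 * u\<^sup>2)" by (simp add: power2_eq_square)
  also have "\<dots> \<le> 3 * (l\<^sup>2 * (P * N))" using three_u_squared_le by linarith
  also have "P * N \<le> 4 * a\<^sup>2" by (simp add: P_def N_def power2_eq_square algebra_simps)
  then have "3 * (l\<^sup>2 * (P * N)) \<le> 3 * (l\<^sup>2 * (4 * a\<^sup>2))" by (intro mult_left_mono) auto
  finally have "(l\<^sup>2 * a\<^sup>2) * l\<^sup>2 \<le> (l\<^sup>2 * a\<^sup>2) * 12" by (simp add: power2_eq_square algebra_simps)
  moreover have "0 < l\<^sup>2 * a\<^sup>2" using l_ge_2 a_pos by simp
  ultimately show ?thesis by (simp only: mult_le_cancel_left_pos)
qed

section \<open>Primes with \<open>l^2 > 12\<close>\<close>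

lemma large_index_odd:
  assumes "\<not> l\<^sup>2 \<le> 12"
  shows "\<not> l dvd 2" "\<not> l dvd 4"
proof -
  show 2: "\<not> l dvd 2"
  proof
    assume "l dvd 2"
    then have "l \<le> 2" by (auto dest: zdvd_imp_le)
    then have "l = 2" using l_ge_2 by simp
    then show False using assms by simp
  qed
  show "\<not> l dvd 4" using 2 prime_dvd_mult_iff[OF l, of 2 2] by simp
qed

lemma large_index_dvd:
  assumes large: "\<not> l\<^sup>2 \<le> 12"
  shows "l dvd u" "l dvd v"
proof -
  note odd = large_index_odd[OF large]
  have half: "l dvd x" if "l dvd 2 * x" for x using that odd prime_dvd_mult_iff[OF l] by blast
  have sum: "a * (p1 + q1)\<^sup>2 + b * (p1 + q1) * (p2 + q2) + a * (p2 + q2)\<^sup>2 = 2 * u + v"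
  proof -
    have "a * (p1 + q1)\<^sup>2 + b * (p1 + q1) * (p2 + q2) + a * (p2 + q2)\<^sup>2
      = (a * p1\<^sup>2 + b * p1 * p2 + a * p2\<^sup>2) + (a * q1\<^sup>2 + b * q1 * q2 + a * q2\<^sup>2) + v"
      by (simp add: v power2_eq_square algebra_simps)
    then show ?thesis unfolding up[symmetric] uq[symmetric] by simp
  qed
  have diff: "a * (p1 - q1)\<^sup>2 + b * (p1 - q1) * (p2 - q2) + a * (p2 - q2)\<^sup>2 = 2 * u - v"
  proof -
    have "a * (p1 - q1)\<^sup>2 + b * (p1 - q1) * (p2 - q2) + a * (p2 - q2)\<^sup>2
      = (a * p1\<^sup>2 + b * p1 * p2 + a * p2\<^sup>2) + (a * q1\<^sup>2 + b * q1 * q2 + a * q2\<^sup>2) - v"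
      by (simp add: v power2_eq_square algebra_simps)
    then show ?thesis unfolding up[symmetric] uq[symmetric] by simp
  qed
  \<comment> \<open>Otherwise the relations for \<open>W\<close> and \<open>Z\<close> make
    \<open>l\<close> divide both; \<open>Z + W\<close> and \<open>Z - W\<close> are twice the
    coordinates of \<open>p - q\<close>, so the odd prime \<open>l\<close> divides
    \<open>p - q\<close>, against \<open>divisible_vector_bound\<close>.\<close>
  have s: "l dvd 2 * u + v"
  proof (rule ccontr)
    assume n: "\<not> ?thesis"
    have "l dvd W * (2 * u + v)" "l dvd Z * (2 * u + v)" unfolding sum_diff_values by auto
    then have WZ: "l dvd W" "l dvd Z" using n prime_dvd_mult_iff[OF l] by blast+
    have "l dvd Z + W" "l dvd Z - W" using WZ by auto
    then have dbl: "l dvd 2 * (p1 - q1)" "l dvd 2 * (p2 - q2)" by (auto simp: Z_def W_def algebra_simps)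
    note dv = dbl[THEN half]
    have "(p1 - q1, p2 - q2) \<noteq> (0, 0)" using det l_ge_2 by auto
    from divisible_vector_bound[OF dv this] show False using large v_bounds unfolding diff by linarith
  qed
  \<comment> \<open>Symmetrically, \<open>X\<close> and \<open>Y\<close> would make
    \<open>p + q\<close> divisible by \<open>l\<close>.\<close>
  have d: "l dvd 2 * u - v"
  proof (rule ccontr)
    assume n: "\<not> ?thesis"
    have "l dvd X * (2 * u - v)" "l dvd Y * (2 * u - v)" unfolding sum_diff_values by auto
    then have XY: "l dvd X" "l dvd Y" using n prime_dvd_mult_iff[OF l] by blast+
    have "l dvd X + Y" "l dvd X - Y" using XY by auto
    then have dbl: "l dvd 2 * (p1 + q1)" "l dvd 2 * (p2 + q2)" by (auto simp: X_def Y_def algebra_simps)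
    note dv = dbl[THEN half]
    have "(p1 + q1, p2 + q2) \<noteq> (0, 0)"
    proof
      assume "(p1 + q1, p2 + q2) = (0, 0)"
      then have "q1 = - p1" "q2 = - p2" by auto
      then show False using det l_ge_2 by simp
    qed
    from divisible_vector_bound[OF dv this] show False using large v_bounds u_ge a_pos unfolding sum by linarith
  qed
  have "l dvd (2 * u + v) + (2 * u - v)" "l dvd (2 * u + v) - (2 * u - v)" using s d by (auto simp only: dvd_add dvd_diff)
  then have "l dvd 4 * u" "l dvd 2 * v" by simp_all
  then show "l dvd u" "l dvd v" using odd prime_dvd_mult_iff[OF l] by blast+
qed

text \<open>If \<open>l\<^sup>2\<close> divided both, the form would be degenerate modulo \<open>l\<close> with the sublattice as its radical,
  and that radical contains \<open>(1, 1)\<close> or \<open>(1, -1)\<close>.\<close>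

lemma large_index_not_square_dvd:
  assumes large: "\<not> l\<^sup>2 \<le> 12"
  shows "\<not> (l\<^sup>2 dvd u \<and> l\<^sup>2 dvd v)"
proof
  note odd = large_index_odd[OF large]
  have half: "l dvd x" if "l dvd 2 * x" for x using that odd prime_dvd_mult_iff[OF l] by blast
  have diag: "\<not> l dvd 1 - m" "\<not> l dvd 1 + m"
    using diagonal_mem_le_2(1) antidiagonal_mem_le_3 large by fastforce+
  \<comment> \<open>\<open>P + N = 4 a\<close> and \<open>P - N = 2 b\<close>, with \<open>l\<close>
    odd and \<open>a\<close>, \<open>b\<close> coprime.\<close>
  have not_both: "\<not> (l dvd P \<and> l dvd N)"
  proof
    assume "l dvd P \<and> l dvd N"
    then have "l dvd P + N" "l dvd P - N" by auto
    then have "l dvd 4 * a" "l dvd 2 * b" by (simp_all add: P_def N_def)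
    then have "l dvd a" "l dvd b" using odd prime_dvd_mult_iff[OF l] by blast+
    then have "l dvd gcd a b" by simp
    then show False using cop l by (auto simp: prime_int_iff)
  qed
  assume "l\<^sup>2 dvd u \<and> l\<^sup>2 dvd v"
  then obtain u2 v2 where uv: "u = l\<^sup>2 * u2" "v = l\<^sup>2 * v2" by (auto elim!: dvdE)
  have l0: "l \<noteq> 0" using l_ge_2 by simp
  \<comment> \<open>\<open>l^4\<close> divides \<open>4 u^2 - v^2 = l^2 P N\<close>, so
    \<open>l\<close> divides \<open>P\<close> or \<open>N\<close>.\<close>
  have "l\<^sup>2 * (P * N) = l\<^sup>2 * (l\<^sup>2 * (4 * u2\<^sup>2 - v2\<^sup>2))"
    unfolding discr_eq[symmetric] uv by (simp add: power2_eq_square algebra_simps)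
  then have "l dvd P * N" using l0 by (simp add: power2_eq_square)
  then consider "l dvd P" | "l dvd N" using prime_dvd_mult_iff[OF l] by blast
  then show False
  proof cases
    case 1
    have nN: "\<not> l dvd N" using 1 not_both by blast
    have "l * (Z * (l * (2 * u2 + v2))) = l * (- (Y * N))"
      using sum_diff_values(2) unfolding uv by (simp add: power2_eq_square algebra_simps)
    then have "Z * (l * (2 * u2 + v2)) = - (Y * N)" using l0 by (simp only: mult_cancel_left simp_thms)
    then have "l dvd Y * N" by (metis dvd_minus_iff dvd_triv_left dvd_mult)
    moreover have "l * (X * (l * (2 * u2 - v2))) = l * (W * N)"
      using sum_diff_values(3) unfolding uv by (simp add: power2_eq_square algebra_simps)
    then have "X * (l * (2 * u2 - v2)) = W * N" using l0 by (simp only: mult_cancel_left simp_thms)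
    then have "l dvd W * N" by (metis dvd_triv_left dvd_mult)
    ultimately have YW: "l dvd Y" "l dvd W" using nN prime_dvd_mult_iff[OF l] by blast+
    have "l dvd Y + W" "l dvd Y - W" using YW by auto
    then have dbl: "l dvd 2 * (p1 - p2)" "l dvd 2 * (q1 - q2)" by (auto simp: Y_def W_def algebra_simps)
    note dv = dbl[THEN half]
    \<comment> \<open>Both \<open>p\<close> and \<open>q\<close> are diagonal modulo
      \<open>l\<close> and satisfy the congruence of the sublattice; so \<open>l * l\<close> divides
      the combination \<open>l * (1 - m)\<close>, and \<open>(1, 1)\<close> lies in the
      sublattice.\<close>
    have "l * l dvd (p1 - p2) * (q1 - m * q2) - (q1 - q2) * (p1 - m * p2)"
      by (rule dvd_diff[OF mult_dvd_mono[OF dv(1) mem(2)] mult_dvd_mono[OF dv(2) mem(1)]])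
    also have "\<dots> = l * (1 - m)" by (simp add: det[symmetric] algebra_simps)
    finally show False using l0 diag by simp
  next
    case 2
    have nP: "\<not> l dvd P" using 2 not_both by blast
    have "l * (W * (l * (2 * u2 + v2))) = l * (X * P)"
      using sum_diff_values(1) unfolding uv by (simp add: power2_eq_square algebra_simps)
    then have "W * (l * (2 * u2 + v2)) = X * P" using l0 by (simp only: mult_cancel_left simp_thms)
    then have "l dvd X * P" by (metis dvd_triv_left dvd_mult)
    moreover have "l * (Y * (l * (2 * u2 - v2))) = l * (- (Z * P))"
      using sum_diff_values(4) unfolding uv by (simp add: power2_eq_square algebra_simps)
    then have "Y * (l * (2 * u2 - v2)) = - (Z * P)" using l0 by (simp only: mult_cancel_left simp_thms)
    then have "l dvd Z * P" by (metis dvd_minus_iff dvd_triv_left dvd_mult)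
    ultimately have XZ: "l dvd X" "l dvd Z" using nP prime_dvd_mult_iff[OF l] by blast+
    have "l dvd X + Z" "l dvd X - Z" using XZ by auto
    then have dbl: "l dvd 2 * (p1 + p2)" "l dvd 2 * (q1 + q2)" by (auto simp: X_def Z_def algebra_simps)
    note dv = dbl[THEN half]
    \<comment> \<open>The antidiagonal counterpart, which puts \<open>(1, -1)\<close> in the
      sublattice.\<close>
    have "l * l dvd (q1 + q2) * (p1 - m * p2) - (p1 + p2) * (q1 - m * q2)"
      by (rule dvd_diff[OF mult_dvd_mono[OF dv(2) mem(1)] mult_dvd_mono[OF dv(1) mem(2)]])
    also have "\<dots> = l * (1 + m)" by (simp add: det[symmetric] algebra_simps)
    finally show False using l0 diag by simp
  qed
qed

text \<open>The inverse change of basis has determinant \<open>1/l\<close>, so a common divisor of the restricted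
  coefficients divides \<open>l\<^sup>2\<close> times the original ones, which are coprime.\<close>

lemma content_dvd:
  assumes "g dvd u" "g dvd v"
  shows "g dvd l\<^sup>2"
proof -
  \<comment> \<open>By Cramer's rule, \<open>l\<close> times \<open>(x, y)\<close> is
    \<open>(x q2 - y q1) p + (p1 y - p2 x) q\<close>.\<close>
  have inv: "l\<^sup>2 * (a * x\<^sup>2 + b * x * y + a * y\<^sup>2) = u * (x * q2 - y * q1)\<^sup>2
      + v * (x * q2 - y * q1) * (p1 * y - p2 * x) + u * (p1 * y - p2 * x)\<^sup>2" for x y
  proof -
    have "l\<^sup>2 * (a * x\<^sup>2 + b * x * y + a * y\<^sup>2) = (a * p1\<^sup>2 + b * p1 * p2 + a * p2\<^sup>2) * (x * q2 - y * q1)\<^sup>2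
      + v * (x * q2 - y * q1) * (p1 * y - p2 * x) + (a * q1\<^sup>2 + b * q1 * q2 + a * q2\<^sup>2) * (p1 * y - p2 * x)\<^sup>2"
      unfolding v det[symmetric] by (simp add: power2_eq_square algebra_simps)
    then show ?thesis unfolding up[symmetric] uq[symmetric] .
  qed
  have dv: "g dvd l\<^sup>2 * (a * x\<^sup>2 + b * x * y + a * y\<^sup>2)" for x y
    unfolding inv using assms by (intro dvd_add dvd_mult2) auto
  from dv[of 1 0] have ga: "g dvd l\<^sup>2 * a" by simp
  from dv[of 1 1] have "g dvd l\<^sup>2 * (a + b + a) - 2 * (l\<^sup>2 * a)"
    using ga by (intro dvd_diff) (simp_all add: dvd_mult)
  also have "l\<^sup>2 * (a + b + a) - 2 * (l\<^sup>2 * a) = l\<^sup>2 * b" by (simp add: algebra_simps)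
  finally have "g dvd gcd (l\<^sup>2 * a) (l\<^sup>2 * b)" using ga by simp
  then show ?thesis using cop by (simp add: gcd_mult_left)
qed

text \<open>For large \<open>l\<close> the content divides \<open>l^2\<close> and is a multiple of
  \<open>l\<close> but not of \<open>l^2\<close>; for the primes 2 and 3 the values of
  \<open>u\<close> and \<open>v\<close> are explicit.\<close>

lemma content_eq: "gcd u v = l"
proof (cases "l\<^sup>2 \<le> 12")
  case True
  then show ?thesis using small_square_cases[OF l] index_two index_three by auto
next
  case False
  let ?g = "gcd u v"
  have lg: "l dvd ?g" using large_index_dvd[OF False] by simp
  then obtain k where k: "?g = l * k" by (rule dvdE)
  have "?g dvd l\<^sup>2" by (rule content_dvd) auto
  then have "k dvd l" using k l_ge_2 by (simp add: power2_eq_square)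
  moreover have "\<not> l dvd k"
  proof
    assume "l dvd k"
    then have "l\<^sup>2 dvd ?g" using k by (simp add: power2_eq_square)
    then show False using large_index_not_square_dvd[OF False] by simp
  qed
  ultimately have "\<bar>k\<bar> = 1" using l by (metis prime_int_iff abs_dvd_iff dvd_abs_iff abs_ge_zero dvd_refl)
  moreover have "k \<ge> 0" using k l_ge_2 by (metis gcd_ge_0_int mult_less_0_iff not_le zero_less_numeral less_le_trans)
  ultimately show ?thesis using k by simp
qed

end

section \<open>Coefficient rings\<close>

lemma csqrt_int_square: "csqrt (of_int D) * csqrt (of_int D) = of_int D"
  using power2_csqrt[of "of_int D"] by (simp add: power2_eq_square)

lemma Im_csqrt_neg:
  assumes "D < 0"
  shows "Im (csqrt (of_int D)) \<noteq> 0"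
  using csqrt_of_real_nonpos[of "of_int D"] assms by simp

text \<open>Writing \<open>w = \<theta> z\<close>, the product \<open>u \<theta>\<close> is an algebraic integer which generates the ring.\<close>

lemma coefficient_ring_rhombic:
  fixes u v D :: int and z w :: complex
  assumes u: "u > 0" and cop: "gcd u v = 1" and D: "D = v\<^sup>2 - 4 * u\<^sup>2" "D < 0"
    and z: "z \<noteq> 0" and w: "2 * of_int u * w = (of_int v + csqrt (of_int D)) * z"
  shows "coefficient_ring (quad_field D) (range (\<lambda>(x::int, y::int). of_int x * z + of_int y * w))
    = range (\<lambda>(m::int, n::int). of_int m + of_int n * ((of_int v + csqrt (of_int D)) / 2))"
    (is "coefficient_ring _ ?L = ?R")
proof -
  define s where "s = csqrt (of_int D)"
  have s2: "s * s = of_int v * of_int v - 4 * of_int u * of_int u"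
    unfolding s_def csqrt_int_square D(1) by (simp add: power2_eq_square)
  have Ims: "Im s \<noteq> 0" unfolding s_def by (rule Im_csqrt_neg[OF D(2)])
  define \<omega> where "\<omega> = (of_int v + s) / 2"
  have u0: "of_int u \<noteq> (0::complex)" using u by simp
  have uw: "of_int u * w = \<omega> * z" using w by (simp add: \<omega>_def s_def[symmetric] field_simps)
  have \<omega>2: "\<omega> * \<omega> = of_int v * \<omega> - of_int u * of_int u"
  proof -
    have "\<omega> * \<omega> = (of_int v * of_int v + 2 * of_int v * s + s * s) / 4"
      by (simp add: \<omega>_def field_simps)
    also have "\<dots> = of_int v * \<omega> - of_int u * of_int u"
      unfolding s2 by (simp add: \<omega>_def field_simps)
    finally show ?thesis .
  qed
  \<comment> \<open>Together with \<open>u w = \<omega> z\<close> this shows that multiplication by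
    \<open>\<omega>\<close> maps the lattice into itself.\<close>
  have \<omega>w: "\<omega> * w = of_int v * w - of_int u * z"
  proof -
    have "of_int u * (\<omega> * w) = \<omega> * (of_int u * w)" by simp
    also have "\<dots> = (\<omega> * \<omega>) * z" by (simp add: uw)
    also have "\<dots> = of_int v * (\<omega> * z) - of_int u * (of_int u * z)"
      unfolding \<omega>2 by (simp add: algebra_simps)
    also have "\<dots> = of_int u * (of_int v * w - of_int u * z)"
      unfolding uw[symmetric] by (simp add: algebra_simps)
    finally show ?thesis using u0 by simp
  qed
  have indep: "r = 0 \<and> t = 0" if "of_int r + of_int t * \<omega> = (0::complex)" for r t
  proof -
    have "Im (of_int r + of_int t * \<omega>) = of_int t * Im s / 2" by (simp add: \<omega>_def)
    then have "t = 0" using that Ims by simp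
    then show ?thesis using that by simp
  qed
  show ?thesis
  proof
    show "coefficient_ring (quad_field D) ?L \<subseteq> ?R"
    proof
      fix \<alpha> assume "\<alpha> \<in> coefficient_ring (quad_field D) ?L"
      then have cl: "\<alpha> * c \<in> ?L" if "c \<in> ?L" for c using that by (auto simp: coefficient_ring_def)
      have "z \<in> ?L" "w \<in> ?L"
        using rangeI[of "\<lambda>(x::int, y::int). of_int x * z + of_int y * w" "(1, 0)"]
          rangeI[of "\<lambda>(x::int, y::int). of_int x * z + of_int y * w" "(0, 1)"] by simp_all
      from this[THEN cl] obtain x y x' y' :: int where
        \<alpha>: "\<alpha> * z = of_int x * z + of_int y * w" "\<alpha> * w = of_int x' * z + of_int y' * w" by auto
      have scaled: "of_int u * (of_int i * z + of_int j * w) = (of_int u * of_int i + of_int j * \<omega>) * z"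
        for i j
      proof -
        have "of_int u * (of_int i * z + of_int j * w) = of_int u * of_int i * z + of_int j * (of_int u * w)"
          by (simp add: algebra_simps)
        then show ?thesis unfolding uw by (simp add: algebra_simps)
      qed
      \<comment> \<open>Multiplying the images of \<open>z\<close> and \<open>w\<close> by
        \<open>u\<close> and cancelling \<open>z\<close> expresses \<open>u \<alpha>\<close> and
        \<open>\<omega> \<alpha>\<close> through 1 and \<open>\<omega>\<close>.\<close>
      have "(of_int u * \<alpha>) * z = of_int u * (\<alpha> * z)" by simp
      then have 1: "of_int u * \<alpha> = of_int u * of_int x + of_int y * \<omega>"
        unfolding \<alpha>(1) scaled using z by simp
      have "(\<omega> * \<alpha>) * z = of_int u * (\<alpha> * w)"
        using uw by (metis mult.assoc mult.commute)
      then have 2: "\<omega> * \<alpha> = of_int u * of_int x' + of_int y' * \<omega>"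
        unfolding \<alpha>(2) scaled using z by simp
      have "of_int u * (of_int u * of_int x' + of_int y' * \<omega>) = \<omega> * (of_int u * \<alpha>)"
        unfolding 2[symmetric] by simp
      also have "\<dots> = of_int u * of_int x * \<omega> + of_int y * (\<omega> * \<omega>)" unfolding 1 by (simp add: algebra_simps)
      finally have "of_int (u * u * x' + u * u * y) + of_int (u * y' - u * x - v * y) * \<omega> = (0::complex)"
        unfolding \<omega>2 by (simp add: algebra_simps)
      \<comment> \<open>Comparing coefficients of \<open>\<omega>\<close> gives
        \<open>u dvd v * y\<close>; primitivity then gives \<open>u dvd y\<close>, which removes the
        denominator of \<open>\<alpha>\<close>.\<close>
      from indep[OF this] have "v * y = u * (y' - x)" by (simp add: algebra_simps)
      then have "u dvd v * y" by simp
      then have "u dvd y" using cop by (simp add: coprime_dvd_mult_right_iff coprime_iff_gcd_eq_1)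
      then obtain n where "y = u * n" by (rule dvdE)
      then have "of_int u * \<alpha> = of_int u * (of_int x + of_int n * \<omega>)" using 1 by (simp add: algebra_simps)
      then have "\<alpha> = of_int x + of_int n * \<omega>" using u0 by simp
      then show "\<alpha> \<in> ?R" unfolding \<omega>_def s_def by auto
    qed
    show "?R \<subseteq> coefficient_ring (quad_field D) ?L"
    proof
      fix \<alpha> assume "\<alpha> \<in> ?R"
      then obtain m n :: int where \<alpha>: "\<alpha> = of_int m + of_int n * \<omega>" by (auto simp: \<omega>_def s_def)
      have "\<alpha> = of_rat (of_int m + of_int n * of_int v / 2) + of_rat (of_int n / 2) * csqrt (of_int D)"
        by (simp add: \<alpha> \<omega>_def s_def of_rat_add of_rat_mult of_rat_divide field_simps)
      then have "\<alpha> \<in> quad_field D" unfolding quad_field_def by (auto intro: Rats_of_rat)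
      moreover have "\<alpha> * c \<in> ?L" if "c \<in> ?L" for c
      proof -
        from that obtain x y :: int where c: "c = of_int x * z + of_int y * w" by auto
        have "\<alpha> * c = of_int m * c + of_int n * (of_int x * (\<omega> * z) + of_int y * (\<omega> * w))"
          by (simp add: \<alpha> c algebra_simps)
        also have "\<dots> = of_int (m * x - n * y * u) * z + of_int (m * y + n * x * u + n * y * v) * w"
          unfolding \<omega>w uw[symmetric] c by (simp add: algebra_simps)
        finally show ?thesis
          by (intro range_eqI[of _ _ "(m * x - n * y * u, m * y + n * x * u + n * y * v)"]) simp
      qed
      ultimately show "\<alpha> \<in> coefficient_ring (quad_field D) ?L" unfolding coefficient_ring_def by blast
    qed
  qed
qed

text \<open>The two generators differ by the integer \<open>(v - v') / 2\<close>.\<close>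

lemma generated_order_shift:
  fixes v v' :: int and s :: complex
  assumes "even (v - v')"
  shows "range (\<lambda>(m::int, n::int). of_int m + of_int n * ((of_int v + s) / 2))
    = range (\<lambda>(m::int, n::int). of_int m + of_int n * ((of_int v' + s) / 2))"
proof -
  have sub: "range (\<lambda>(m::int, n::int). of_int m + of_int n * ((of_int v + s) / 2))
    \<subseteq> range (\<lambda>(m::int, n::int). of_int m + of_int n * ((of_int v' + s) / 2))"
    if "even (v - v')" for v v'
  proof
    from that obtain k where "v - v' = 2 * k" by (rule evenE)
    then have v: "v = v' + 2 * k" by simp
    fix c assume "c \<in> range (\<lambda>(m::int, n::int). of_int m + of_int n * ((of_int v + s) / 2))"
    then obtain m n :: int where "c = of_int m + of_int n * ((of_int v + s) / 2)" by auto
    then have "c = (case (m + n * k, n) of (m, n) \<Rightarrow> of_int m + of_int n * ((of_int v' + s) / 2))"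
      unfolding v by (simp add: field_simps)
    then show "c \<in> range (\<lambda>(m::int, n::int). of_int m + of_int n * ((of_int v' + s) / 2))"
      by (rule range_eqI)
  qed
  have "even (v' - v)" using assms by simp
  from sub[OF assms] sub[OF this] show ?thesis by blast
qed

section \<open>The embedding into the quadratic field\<close>

lemma field_embed_lin_comb:
  "field_embed (BQF a b c) (lin_comb p q w)
    = of_int (fst w) * field_embed (BQF a b c) p + of_int (snd w) * field_embed (BQF a b c) q"
  by (cases p; cases q) (simp add: lin_comb_def algebra_simps add_divide_distrib)

lemma two_a_field_embed:
  assumes "a \<noteq> 0" "D = discr (BQF a b c)"
  shows "2 * of_int a * field_embed (BQF a b c) (x, y)
    = 2 * of_int a * of_int x + of_int y * (of_int b + csqrt (of_int D))"
  using assms(1) unfolding assms(2) by (simp add: field_simps)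

lemma field_embed_eq_0:
  assumes "a \<noteq> 0" "discr (BQF a b c) < 0" "field_embed (BQF a b c) (x, y) = 0"
  shows "x = 0 \<and> y = 0"
proof -
  define s where "s = csqrt (of_int (discr (BQF a b c)))"
  have "Im s \<noteq> 0" unfolding s_def by (rule Im_csqrt_neg[OF assms(2)])
  moreover have 0: "2 * of_int a * of_int x + of_int y * (of_int b + s) = 0"
    using two_a_field_embed[OF assms(1) refl, of b c x y] assms(3) by (simp add: s_def)
  then have "Im (2 * of_int a * of_int x + of_int y * (of_int b + s)) = 0" by simp
  ultimately have "y = 0" by simp
  then show ?thesis using 0 assms(1) by simp
qed

text \<open>For negative \<open>D\<close> the squared absolute value is the form divided by
  \<open>a\<close>; in the quotient of the two images \<open>v\<close> comes from the polar form and
  \<open>l\<close> from the oriented area.\<close>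

lemma field_embed_ratio:
  fixes a b p1 p2 q1 q2 u v l :: int
  assumes "a \<noteq> 0" and D: "D = discr (BQF a b a)"
    and up: "u = a * p1\<^sup>2 + b * p1 * p2 + a * p2\<^sup>2"
    and v: "v = 2 * a * p1 * q1 + b * (p1 * q2 + p2 * q1) + 2 * a * p2 * q2"
    and l: "l = p1 * q2 - p2 * q1"
  shows "2 * of_int u * field_embed (BQF a b a) (q1, q2)
    = (of_int v + of_int l * csqrt (of_int D)) * field_embed (BQF a b a) (p1, p2)"
proof -
  define s where "s = csqrt (of_int D)"
  have s2: "s * s = of_int b * of_int b - 4 * of_int a * of_int a"
    unfolding s_def csqrt_int_square D by (simp add: power2_eq_square)
  define f where "f = field_embed (BQF a b a)"
  have a2: "(2 * of_int a :: complex) \<noteq> 0" using assms(1) by simp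
  have f: "2 * of_int a * f (x, y) = 2 * of_int a * of_int x + of_int y * (of_int b + s)" for x y
    unfolding f_def s_def by (rule two_a_field_embed[OF assms(1) D])
  have "2 * of_int a * (2 * of_int u * f (q1, q2)) = 2 * of_int u * (2 * of_int a * f (q1, q2))"
    by simp
  \<comment> \<open>As polynomials in \<open>s\<close> the two sides differ by a multiple of
    \<open>s * s - (b^2 - 4 a^2)\<close>; writing it out makes this a purely algebraic
    identity.\<close>
  also have "\<dots> = (of_int v + of_int l * s) * (2 * of_int a * f (p1, p2))
      - of_int p2 * of_int l * (s * s - (of_int b * of_int b - 4 * of_int a * of_int a))"
    unfolding f up v l by (simp add: power2_eq_square algebra_simps)
  also have "\<dots> = 2 * of_int a * ((of_int v + of_int l * s) * f (p1, p2))"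
    unfolding s2 by simp
  finally show ?thesis using a2 unfolding f_def s_def by (simp only: mult_cancel_left simp_thms)
qed

section \<open>Reduction and temperament\<close>

definition det2 :: "int \<times> int \<Rightarrow> int \<times> int \<Rightarrow> int" where
  "det2 p q = fst p * snd q - fst q * snd p"

lemma det2_lin_comb: "det2 (lin_comb p q w) (lin_comb p q z) = det2 w z * det2 p q"
  by (simp add: det2_def lin_comb_def algebra_simps)

lemma det2_swap: "det2 q p = - det2 p q"
  by (simp add: det2_def)

lemma lin_comb_det2: "lin_comb p q (det2 x q, det2 p x) = (det2 p q * fst x, det2 p q * snd x)"
  by (simp add: det2_def lin_comb_def algebra_simps)

lemma in_coords_BQF:
  "in_coords (BQF a b c) (p1, p2) (q1, q2) =
    BQF (a * p1\<^sup>2 + b * p1 * p2 + c * p2\<^sup>2)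
      (2 * a * p1 * q1 + b * (p1 * q2 + p2 * q1) + 2 * c * p2 * q2)
      (a * q1\<^sup>2 + b * q1 * q2 + c * q2\<^sup>2)"
  by (simp add: in_coords_def bqf_at_def power2_eq_square algebra_simps)

lemma in_coords_lin_comb:
  "in_coords (in_coords F p q) w z = in_coords F (lin_comb p q w) (lin_comb p q z)"
proof -
  have "lin_comb p q (w + z) = lin_comb p q w + lin_comb p q z"
    by (simp add: lin_comb_def algebra_simps)
  then show ?thesis
    unfolding in_coords_def[of "in_coords F p q"] bqf_at_in_coords by (simp add: in_coords_def)
qed

lemma properly_equivalent_iff:
  "properly_equivalent F G \<longleftrightarrow> (\<exists>p q. det2 p q = 1 \<and> G = in_coords F p q)"
  by (simp add: properly_equivalent_def det2_def)

lemma properly_equivalent_refl: "properly_equivalent F F"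
  unfolding properly_equivalent_iff
proof (intro exI conjI)
  show "det2 (1, 0) (0, 1) = 1" by (simp add: det2_def)
  show "F = in_coords F (1, 0) (0, 1)" by (cases F) (simp add: in_coords_BQF)
qed

text \<open>The first basis has determinant 1, so Cramer's rule gives integral coordinates of the
  second basis in the first. With reflexivity this law yields symmetry.\<close>

lemma properly_equivalent_euclidean:
  assumes "properly_equivalent H F" "properly_equivalent H G"
  shows "properly_equivalent F G"
proof -
  from assms obtain p q p' q' where
    F: "det2 p q = 1" "F = in_coords H p q" and G: "det2 p' q' = 1" "G = in_coords H p' q'"
    unfolding properly_equivalent_iff by blast
  have x: "lin_comb p q (det2 x q, det2 p x) = x" for x
    using lin_comb_det2[of p q x] F(1) by simp
  define w z where "w = (det2 p' q, det2 p p')" and "z = (det2 q' q, det2 p q')"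
  have wz: "lin_comb p q w = p'" "lin_comb p q z = q'" by (simp_all add: w_def z_def x)
  have "det2 w z = 1" using det2_lin_comb[of p q w z] wz F(1) G(1) by simp
  moreover have "G = in_coords F w z" unfolding F(2) G(2) in_coords_lin_comb wz ..
  ultimately show ?thesis unfolding properly_equivalent_iff by blast
qed

text \<open>The leading coefficient \<open>\<alpha>\<close> is a value of \<open>(u, v, u)\<close>,
  so at least \<open>u\<close>. Conversely a basis of vectors of value \<open>u\<close> in the
  coordinates of \<open>G\<close> has one off the first axis, so \<open>\<delta> \<le> u\<close>.
  The discriminant then gives \<open>\<beta>\<close> up to sign, and the convention for equal outer
  coefficients fixes the sign.\<close>

lemma properly_equivalent_reduced_rhombic:
  assumes red: "reduced (BQF u v u)" "reduced G" and pe: "properly_equivalent (BQF u v u) G"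
  shows "G = BQF u v u"
proof -
  obtain \<alpha> \<beta> \<delta> where G: "G = BQF \<alpha> \<beta> \<delta>" by (cases G)
  have r: "\<bar>v\<bar> \<le> u" "v \<le> 0" "\<bar>\<beta>\<bar> \<le> \<alpha>" "\<alpha> \<le> \<delta>" "\<alpha> = \<delta> \<Longrightarrow> \<beta> \<le> 0" using red by (auto simp: G)
  obtain p1 p2 q1 q2 where d: "p1 * q2 - q1 * p2 = 1" and "G = in_coords (BQF u v u) (p1, p2) (q1, q2)"
    using pe unfolding properly_equivalent_def by auto
  then have abd: "\<alpha> = u * p1\<^sup>2 + v * p1 * p2 + u * p2\<^sup>2"
      "\<beta> = 2 * u * p1 * q1 + v * (p1 * q2 + p2 * q1) + 2 * u * p2 * q2"
      "\<delta> = u * q1\<^sup>2 + v * q1 * q2 + u * q2\<^sup>2"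
    by (simp_all add: G in_coords_BQF)
  have nz: "(p1, p2) \<noteq> (0, 0)" using d by auto
  have u_le: "u \<le> \<alpha>" unfolding abd by (rule reduced_form_ge(1)[OF r(1) order_refl nz])
  have "properly_equivalent G (BQF u v u)"
    using properly_equivalent_euclidean[OF pe properly_equivalent_refl] .
  then obtain x1 x2 y1 y2 where e: "x1 * y2 - y1 * x2 = 1" and "BQF u v u = in_coords G (x1, x2) (y1, y2)"
    unfolding properly_equivalent_def by auto
  then have uG: "u = \<alpha> * x1\<^sup>2 + \<beta> * x1 * x2 + \<delta> * x2\<^sup>2" "u = \<alpha> * y1\<^sup>2 + \<beta> * y1 * y2 + \<delta> * y2\<^sup>2"
    by (simp_all add: G in_coords_BQF)
  have nz': "(x1, x2) \<noteq> (0, 0)" "(y1, y2) \<noteq> (0, 0)" "x2 \<noteq> 0 \<or> y2 \<noteq> 0" using e by auto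
  have "\<delta> \<le> u"
    using reduced_form_ge(2)[OF r(3,4) nz'(1)] reduced_form_ge(2)[OF r(3,4) nz'(2)] uG nz'(3) by metis
  then have eq: "\<alpha> = u" "\<delta> = u" using u_le r(4) by auto
  have "4 * \<alpha> * \<delta> - \<beta>\<^sup>2 = (p1 * q2 - p2 * q1)\<^sup>2 * (4 * u * u - v\<^sup>2)"
    unfolding abd by (rule restricted_discriminant)
  moreover have "p1 * q2 - p2 * q1 = 1" using d by (simp add: mult.commute)
  ultimately have "\<beta>\<^sup>2 = v\<^sup>2" using eq by simp
  then have "\<beta> = v" using r(2,5) eq by (auto simp: power2_eq_iff)
  then show ?thesis using eq by (simp add: G)
qed

lemma reduction_rhombic:
  assumes "reduced (BQF u v u)" "properly_equivalent F (BQF u v u)"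
  shows "reduction F = BQF u v u"
  unfolding reduction_def
  using assms properly_equivalent_euclidean properly_equivalent_reduced_rhombic
  by (intro the_equality) blast+

lemma pos_def_rhombic:
  assumes "\<bar>v\<bar> \<le> u" "u > (0::int)"
  shows "pos_def (map_bqf real_of_int (BQF u v u))"
  unfolding pos_def_def
proof (intro allI impI)
  fix x y :: real
  assume nz: "(x, y) \<noteq> (0, 0)"
  have "2 * u + v > 0" "2 * u - v > 0" using assms by auto
  then have pos: "2 * real_of_int u + real_of_int v > 0" "2 * real_of_int u - real_of_int v > 0" by linarith+
  have nz2: "x + y \<noteq> 0 \<or> x - y \<noteq> 0" using nz by auto
  have "0 < (2 * real_of_int u + real_of_int v) * (x + y)\<^sup>2 + (2 * real_of_int u - real_of_int v) * (x - y)\<^sup>2"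
    using nz2
  proof
    assume "x + y \<noteq> 0"
    then show ?thesis using pos by (intro add_pos_nonneg) auto
  next
    assume "x - y \<noteq> 0"
    then show ?thesis using pos by (intro add_nonneg_pos) auto
  qed
  then show "bqf_val (map_bqf real_of_int (BQF u v u)) x y > 0"
    unfolding rhombic_form_diagonal[symmetric] by simp
qed

section \<open>Scaling and temperament\<close>

lemma bqf_at_scaled:
  "bqf_at (smult_bqf k (map_bqf real_of_int F)) x = k * real_of_int (bqf_at F x)"
  by (cases F) (simp add: bqf_at_def smult_bqf_def algebra_simps)

text \<open>As \<open>U \<ge> 1\<close>, the scaled form is at least 1 at every non-zero vector and
  equals 1 on \<open>S\<close>; hence the scalar is the reciprocal of the minimum \<open>a\<close>
  of \<open>F\<close>, and \<open>S'\<close> consists of minimal vectors of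
  \<open>M\<close>.\<close>

lemma tempered_perfect_scale:
  assumes M: "sublattice M" and k: "k > 0"
    and tp: "normalized_tempered_perfect M S S' (smult_bqf k (map_bqf real_of_int F)) U"
    and min: "\<forall>x. x \<noteq> 0 \<longrightarrow> a \<le> bqf_at F x" and att: "y \<noteq> 0" "bqf_at F y = a"
  shows "k * real_of_int a = 1"
    and "\<And>x. x \<in> S' \<Longrightarrow> U = real_of_int (bqf_at F x) / real_of_int a"
    and "\<And>x x'. x \<in> S' \<Longrightarrow> x' \<in> M - {0} \<Longrightarrow> bqf_at F x \<le> bqf_at F x'"
proof -
  let ?f = "\<lambda>x. k * real_of_int (bqf_at F x)"
  have S: "S \<noteq> {}" "S \<subseteq> - M" "S' \<subseteq> M - {0}" "U \<ge> 1"
    and vals: "\<And>x. x \<in> S \<Longrightarrow> ?f x = 1" "\<And>x. x \<notin> M \<Longrightarrow> x \<notin> S \<Longrightarrow> ?f x > 1"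
      "\<And>x. x \<in> S' \<Longrightarrow> ?f x = U" "\<And>x. x \<in> M - {0} \<Longrightarrow> x \<notin> S' \<Longrightarrow> ?f x > U"
    using tp unfolding normalized_tempered_perfect_def tempered_def bqf_at_scaled by auto
  have M_ge: "?f x \<ge> U" if "x \<in> M - {0}" for x
    using vals(3)[of x] vals(4)[of x] that by (cases "x \<in> S'") auto
  have ge1: "?f x \<ge> 1" if "x \<noteq> 0" for x
  proof (cases "x \<in> M")
    case True
    then show ?thesis using M_ge[of x] that S(4) by simp
  next
    case False
    then show ?thesis using vals(1)[of x] vals(2)[of x] by (cases "x \<in> S") auto
  qed
  from S(1) obtain x where x: "x \<in> S" by blast
  have "0 \<in> M" using M by (simp add: sublattice_def)
  then have "x \<noteq> 0" using x S(2) by auto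
  then have "real_of_int a \<le> real_of_int (bqf_at F x)" using min by (metis of_int_le_iff)
  then have "k * real_of_int a \<le> ?f x" using k by (intro mult_left_mono) auto
  then have "k * real_of_int a \<le> 1" using vals(1)[OF x] by linarith
  moreover have "k * real_of_int a \<ge> 1" using ge1[OF att(1)] att(2) by simp
  ultimately show ka: "k * real_of_int a = 1" by linarith
  have a0: "real_of_int a \<noteq> 0" using ka by auto
  fix x assume x': "x \<in> S'"
  have "U = k * real_of_int a * (real_of_int (bqf_at F x) / real_of_int a)"
    using vals(3)[OF x'] a0 by simp
  then show "U = real_of_int (bqf_at F x) / real_of_int a" unfolding ka by simp
  fix x' assume "x' \<in> M - {0}"
  then have "?f x \<le> ?f x'" using M_ge vals(3)[OF x'] by simp
  then show "bqf_at F x \<le> bqf_at F x'" using k by simp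
qed

text \<open>The description in \<open>temperament\<close> has a unique solution: any two choices of
  scalar and sets have the same value of \<open>F\<close> on their minimal vectors of
  \<open>M\<close>, and \<open>U\<close> is that value over \<open>a\<close>.\<close>

lemma temperament_squared:
  assumes M: "sublattice M" and k: "k > 0"
    and tp: "normalized_tempered_perfect M S S' (smult_bqf k (map_bqf real_of_int F)) U"
    and min: "\<forall>x. x \<noteq> 0 \<longrightarrow> a \<le> bqf_at F x" and att: "y \<noteq> 0" "bqf_at F y = a"
  shows "(temperament (map_bqf real_of_int F) M)\<^sup>2 = U"
proof -
  note scale = tempered_perfect_scale[OF M _ _ min att]
  have "U' = U" if k': "k' > 0"
    and tp': "normalized_tempered_perfect M T T' (smult_bqf k' (map_bqf real_of_int F)) U'" for k' T T' U'
  proof -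
    have "S' \<noteq> {}" "T' \<noteq> {}" and sub: "S' \<subseteq> M - {0}" "T' \<subseteq> M - {0}"
      using tp tp' by (auto simp: normalized_tempered_perfect_def)
    then obtain x x' where x: "x \<in> S'" "x' \<in> T'" by blast
    have "bqf_at F x = bqf_at F x'"
      using scale(3)[OF k tp x(1)] scale(3)[OF k' tp' x(2)] x sub by (meson antisym subsetD)
    then show ?thesis using scale(2)[OF k tp x(1)] scale(2)[OF k' tp' x(2)] by simp
  qed
  then have "(THE U. \<exists>k>0. \<exists>S S'. normalized_tempered_perfect M S S' (smult_bqf k (map_bqf real_of_int F)) U) = U"
    using k tp by (intro the_equality) blast+
  moreover have "U \<ge> 1" using tp by (simp add: normalized_tempered_perfect_def tempered_def)
  ultimately show ?thesis by (simp add: temperament_def)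
qed

section \<open>Index and change of basis\<close>

lemma lattice_index_UNIV: "lattice_index UNIV = 1"
proof -
  have "UNIV // {(v :: int \<times> int, w). v - w \<in> UNIV} = {UNIV}" by (auto simp: quotient_def)
  then show ?thesis by (simp add: lattice_index_def)
qed

lemma unimodular_sublattice:
  assumes "sublattice M" "p \<in> M" "q \<in> M" "(det2 p q)\<^sup>2 = 1"
  shows "M = UNIV"
proof -
  have "x \<in> M" for x
  proof -
    have "lin_comb p q (det2 p q * det2 x q, det2 p q * det2 p x)
      = ((det2 p q)\<^sup>2 * fst x, (det2 p q)\<^sup>2 * snd x)"
      by (simp add: det2_def lin_comb_def power2_eq_square algebra_simps)
    then have "lin_comb p q (det2 p q * det2 x q, det2 p q * det2 p x) = x" using assms(4) by simp
    then show ?thesis using sublattice_lin_comb[OF assms(1-3)] by metis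
  qed
  then show ?thesis by auto
qed

text \<open>Each basis is integral in the other, so the transition determinants multiply to 1. The
  sign stays open because \<open>int_basis\<close> carries no orientation.\<close>

lemma basis_change_det:
  assumes basis: "int_basis M p' q'" and mem: "p \<in> M" "q \<in> M" "det2 p q \<noteq> 0"
    and gen: "\<And>x. x \<in> M \<Longrightarrow> \<exists>z. x = lin_comb p q z"
  obtains w z where "p = lin_comb p' q' w" "q = lin_comb p' q' z" "\<bar>det2 w z\<bar> = 1"
proof -
  have M: "M = range (lin_comb p' q')" using basis by (auto simp: int_basis_def bij_betw_def)
  from mem M obtain w z where wz: "p = lin_comb p' q' w" "q = lin_comb p' q' z" by auto
  have "lin_comb p' q' (1, 0) \<in> M" "lin_comb p' q' (0, 1) \<in> M" by (auto simp: M)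
  then have "p' \<in> M" "q' \<in> M" by (simp_all add: lin_comb_def)
  then obtain x y where xy: "p' = lin_comb p q x" "q' = lin_comb p q y" using gen by blast
  have "det2 p q = det2 w z * det2 p' q'" unfolding wz by (rule det2_lin_comb)
  also have "det2 p' q' = det2 x y * det2 p q" unfolding xy by (rule det2_lin_comb)
  finally have "det2 w z * det2 x y = 1" using mem(3) by simp
  then have "\<bar>det2 w z\<bar> = 1" by (auto simp: zmult_eq_1_iff)
  then show ?thesis using that wz by blast
qed

theorem proposition5:
  fixes l :: nat and M :: "(int \<times> int) set" and a b D :: int
  assumes "prime l"
    and "sublattice M" and "lattice_index M = l"
    and "primitive (BQF a b a)" and "reduced (BQF a b a)"
    and "pos_def (map_bqf real_of_int (BQF a b a))"
    and "doubly_well_rounded (map_bqf real_of_int (BQF a b a)) M"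
    and "D = discr (BQF a b a)"
  shows "(\<exists>u v u1 v1 :: int.
      (\<forall>p q. int_basis M p q \<longrightarrow> reduction (in_coords (BQF a b a) p q) = BQF u v u) \<and>
      gcd u v = int l \<and>
      u = int l * u1 \<and> v = int l * v1 \<and>
      pos_def (map_bqf real_of_int (BQF u1 v1 u1)) \<and>
      primitive (BQF u1 v1 u1) \<and> reduced (BQF u1 v1 u1) \<and>
      discr (BQF u1 v1 u1) = D \<and>
      (temperament (map_bqf real_of_int (BQF a b a)) M)\<^sup>2 = real l * (real_of_int u1 / real_of_int a)) \<and>
      coefficient_ring (quad_field D) (field_embed (BQF a b a) ` UNIV) =
        coefficient_ring (quad_field D) (field_embed (BQF a b a) ` M)"
proof -

  \<comment> \<open>A basis of minimal vectors of the sublattice\<close>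
  define F where "F = BQF a b a"
  have F_at: "bqf_at F (x, y) = a * x\<^sup>2 + b * x * y + a * y\<^sup>2" for x y
    by (simp add: F_def bqf_at_def)
  have b: "\<bar>b\<bar> \<le> a" "b \<le> 0" using assms(5) by auto
  have cop: "gcd a b = 1" using assms(4) by (simp add: gcd.commute gcd.left_commute)
  have a: "a > 0"
  proof -
    have "bqf_val (map_bqf real_of_int (BQF a b a)) 1 0 > 0" using assms(6) unfolding pos_def_def by (metis prod.inject zero_neq_one)
    then show ?thesis by simp
  qed
  have min: "\<forall>x. x \<noteq> 0 \<longrightarrow> a \<le> bqf_at F x"
    using reduced_form_ge(1)[OF b(1) order_refl] by (auto simp: F_at zero_prod_def)
  have att: "(1, 0) \<noteq> (0 :: int \<times> int)" "bqf_at F (1, 0) = a" by (simp_all add: F_at zero_prod_def)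
  obtain k S S' U where k: "k > 0"
    and tp: "normalized_tempered_perfect M S S' (smult_bqf k (map_bqf real_of_int F)) U"
    and "two_pairs S'"
    using assms(7) unfolding doubly_well_rounded_def F_def[symmetric] by blast
  note scale = tempered_perfect_scale[OF assms(2) k tp min att]
  from \<open>two_pairs S'\<close> obtain p0 q0 where pq0: "p0 \<in> S'" "q0 \<in> S'" "- q0 \<in> S'" "q0 \<noteq> p0" "q0 \<noteq> - p0"
    unfolding two_pairs_def by auto
  have S'M: "S' \<subseteq> M - {0}" and U1: "U \<ge> 1"
    using tp by (auto simp: normalized_tempered_perfect_def tempered_def)
  define u where "u = bqf_at F p0"
  have u_min: "u \<le> bqf_at F x" if "x \<in> M - {0}" for x
    unfolding u_def using scale(3) pq0(1) that .
  have S'u: "bqf_at F x = u" if "x \<in> S'" for x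
    using scale(3)[OF that, of p0] u_min[of x] that pq0(1) S'M unfolding u_def by force
  have U: "U = real_of_int u / real_of_int a" using scale(2)[OF pq0(1)] by (simp add: u_def)
  have "p0 \<noteq> 0" using S'M pq0(1) by auto
  then have "a \<le> u" using min unfolding u_def by metis
  then have u_pos: "u > 0" using a by linarith
  have det0: "det2 p0 q0 \<noteq> 0"
  proof
    assume "det2 p0 q0 = 0"
    then have d: "fst p0 * snd q0 - snd p0 * fst q0 = 0" by (simp add: det2_def mult.commute)
    have vals: "u = a * (fst x)\<^sup>2 + b * fst x * snd x + a * (snd x)\<^sup>2" if "x \<in> S'" for x
      using S'u[OF that] F_at[of "fst x" "snd x"] by simp
    have "u \<noteq> 0" using u_pos by simp
    from equal_value_collinear[OF this vals[OF pq0(1)] vals[OF pq0(2)] d]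
    have "q0 = p0 \<or> q0 = - p0" by (simp add: prod_eq_iff)
    then show False using pq0(4,5) by blast
  qed
  define B where "B p q = 2 * a * fst p * fst q + b * (fst p * snd q + snd p * fst q) + 2 * a * snd p * snd q"
    for p q :: "int \<times> int"
  \<comment> \<open>Replacing \<open>q0\<close> by its negative if necessary makes \<open>B\<close>
    non-positive; exchanging the two vectors can then make the determinant positive and keeps
    \<open>B\<close>.\<close>
  define good where "good p q \<longleftrightarrow> p \<in> S' \<and> q \<in> S' \<and> det2 p q \<noteq> 0 \<and> B p q \<le> 0" for p q
  have "\<exists>q. good p0 q"
  proof (cases "B p0 q0 \<le> 0")
    case True
    then show ?thesis using pq0 det0 by (intro exI[of _ q0]) (simp add: good_def)
  next
    case False
    moreover have "B p0 (- q0) = - B p0 q0" by (simp add: B_def algebra_simps)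
    ultimately have "B p0 (- q0) \<le> 0" by simp
    moreover have "det2 p0 (- q0) = - det2 p0 q0" by (simp add: det2_def)
    ultimately show ?thesis using pq0 det0 by (intro exI[of _ "- q0"]) (simp add: good_def)
  qed
  then obtain q where "good p0 q" by blast
  moreover from this have "good q p0"
    unfolding good_def det2_swap[of q p0] by (simp add: B_def mult_ac add_ac)
  moreover have "det2 p0 q > 0 \<or> det2 q p0 > 0"
    using \<open>good p0 q\<close> det2_swap[of q p0] by (auto simp: good_def)
  ultimately obtain p q where pq: "good p q" "det2 p q > 0" by blast
  obtain p1 p2 q1 q2 where p: "p = (p1, p2)" and q: "q = (q1, q2)" by (cases p; cases q)
  define v where "v = B p q"
  have v: "v = 2 * a * p1 * q1 + b * (p1 * q2 + p2 * q1) + 2 * a * p2 * q2" by (simp add: v_def B_def p q)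
  have mem: "(p1, p2) \<in> M" "(q1, q2) \<in> M" using pq S'M by (auto simp: good_def p q)
  have up: "u = a * p1\<^sup>2 + b * p1 * p2 + a * p2\<^sup>2" and uq: "u = a * q1\<^sup>2 + b * q1 * q2 + a * q2\<^sup>2"
    using S'u[of p] S'u[of q] pq by (simp_all add: good_def p q F_at)
  have det: "p1 * q2 - p2 * q1 = det2 p q" by (simp add: det2_def p q mult.commute)
  have det_pos: "p1 * q2 - p2 * q1 \<noteq> 0" using pq(2) det by simp
  note gen = minimal_vectors_generate[OF assms(2) mem u_pos up uq v det_pos]
  have min': "u \<le> a * x\<^sup>2 + b * x * y + a * y\<^sup>2" if "(x, y) \<in> M" "(x, y) \<noteq> (0, 0)" for x y
    using u_min[of "(x, y)"] that by (simp add: F_at zero_prod_def)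
  have v_le: "\<bar>v\<bar> \<le> u" by (rule gen(1)) (rule min')
  have gen: "\<exists>z. w = lin_comb p q z" if "w \<in> M" for w
    unfolding p q by (rule gen(2)) (use min' that in auto)
  have v0: "v \<le> 0" using pq(1) by (simp add: good_def v_def)

  \<comment> \<open>The sublattice as a congruence\<close>
  have disc: "4 * u * u - v\<^sup>2 = (det2 p q)\<^sup>2 * (4 * a * a - b\<^sup>2)"
    using restricted_discriminant[of a p1 b p2 a q1 q2] unfolding up[symmetric] uq[symmetric] v[symmetric] det .
  have bb: "b\<^sup>2 \<le> a\<^sup>2" using b a by (intro abs_le_square_iff[THEN iffD1]) auto
  \<comment> \<open>If a minimal vector of \<open>F\<close> lay in \<open>M\<close>, then
    \<open>u \<le> a\<close> and \<open>3 a^2 (det2 p q)^2 \<le> 4 u^2 - v^2 \<le> 4 a^2\<close>, so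
    \<open>p\<close>, \<open>q\<close> would generate \<open>Z^2\<close>, whose index 1 is not
    prime.\<close>
  have not_mem: "z \<notin> M" if z: "z \<noteq> 0" "bqf_at F z = a" for z
  proof
    assume "z \<in> M"
    then have "u \<le> a" using u_min[of z] z by simp
    then have "u * u \<le> a * a" using u_pos by (intro mult_mono) auto
    moreover have "3 * (a * a) \<le> 4 * a * a - b\<^sup>2" using bb by (simp add: power2_eq_square)
    then have "(det2 p q)\<^sup>2 * (3 * (a * a)) \<le> (det2 p q)\<^sup>2 * (4 * a * a - b\<^sup>2)"
      by (intro mult_left_mono) auto
    moreover have "4 * u * u - v\<^sup>2 \<le> 4 * (u * u)" by simp
    ultimately have "(det2 p q)\<^sup>2 * (3 * (a * a)) \<le> 4 * (a * a)" using disc by linarith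
    then have "(a * a) * (3 * (det2 p q)\<^sup>2) \<le> (a * a) * 4" by (simp only: mult_ac)
    moreover have "a * a > 0" using a by simp
    ultimately have "3 * (det2 p q)\<^sup>2 \<le> 4" by (simp only: mult_le_cancel_left_pos)
    moreover have "(det2 p q)\<^sup>2 \<ge> 1" using pq(2) by (simp add: int_one_le_iff_zero_less)
    ultimately have "(det2 p q)\<^sup>2 = 1" by linarith
    then have "M = UNIV" using unimodular_sublattice[OF assms(2)] mem p q by blast
    then show False using assms(1,3) lattice_index_UNIV not_prime_1 by metis
  qed
  have e1: "(1, 0) \<notin> M" and e2: "(0, 1) \<notin> M"
    by (rule not_mem; simp add: F_at zero_prod_def)+
  obtain m where M: "\<And>x y. (x, y) \<in> M \<longleftrightarrow> int l dvd x - m * y"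
    using sublattice_prime_index[OF assms(2,1,3) e1] by blast
  have l: "prime (int l)" using assms(1) by simp
  have m: "\<not> int l dvd m" using e2 by (simp add: M)
  \<comment> \<open>The congruence makes \<open>l\<close> divide the determinant of
    \<open>p\<close>, \<open>q\<close>. Conversely \<open>(l, 0)\<close> and \<open>(m, 1)\<close>
    lie in \<open>M\<close> and have determinant \<open>l\<close>; being combinations of
    \<open>p\<close> and \<open>q\<close>, they make that determinant divide
    \<open>l\<close>.\<close>
  have det_l: "p1 * q2 - p2 * q1 = int l"
  proof (rule zdvd_antisym_nonneg)
    show "0 \<le> p1 * q2 - p2 * q1" "0 \<le> int l" using det pq(2) by simp_all
    have "int l dvd (p1 - m * p2) * q2 - p2 * (q1 - m * q2)"
      using mem unfolding M by (rule dvd_diff[OF dvd_mult2 dvd_mult])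
    then show "int l dvd p1 * q2 - p2 * q1" by (simp add: algebra_simps)
    obtain w z where "(int l, 0) = lin_comb p q w" "(m, 1) = lin_comb p q z"
      using gen[of "(int l, 0)"] gen[of "(m, 1)"] by (auto simp: M)
    then have "det2 (int l, 0) (m, 1) = det2 w z * det2 p q" by (metis det2_lin_comb)
    then have "int l = det2 w z * det2 p q" by (simp add: det2_def)
    then show "p1 * q2 - p2 * q1 dvd int l" unfolding det by simp
  qed

  \<comment> \<open>The primitive form of discriminant \<open>D\<close>\<close>
  interpret R: rhombic_sublattice a b "int l" u v m p1 p2 q1 q2
    using l b a cop up uq v det_l v_le v0 mem m min' by unfold_locales (auto simp: M)
  have gcd: "gcd u v = int l" by (rule R.content_eq)
  have l0: "int l > 0" using R.l_ge_2 by simp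
  obtain u1 where u1: "u = int l * u1" using gcd by (metis gcd_dvd1 dvdE)
  obtain v1 where v1: "v = int l * v1" using gcd by (metis gcd_dvd2 dvdE)
  have u1_pos: "u1 > 0" using u_pos l0 by (simp add: u1 zero_less_mult_iff)
  have v1_le: "\<bar>v1\<bar> \<le> u1" using v_le l0 by (simp add: u1 v1 abs_mult)
  have v1_0: "v1 \<le> 0" using v0 l0 by (simp add: v1 mult_le_0_iff)
  have cop1: "gcd u1 v1 = 1"
  proof -
    have "int l * gcd u1 v1 = int l * 1" using gcd by (simp add: u1 v1 gcd_mult_left)
    then show ?thesis using l0 by simp
  qed
  have D: "D = v1\<^sup>2 - 4 * u1\<^sup>2" "D = b\<^sup>2 - 4 * a\<^sup>2"
  proof -
    show Da: "D = b\<^sup>2 - 4 * a\<^sup>2" using assms(8) by (simp add: power2_eq_square)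
    have minus_D: "4 * a * a - b\<^sup>2 = - D" unfolding Da by (simp add: power2_eq_square)
    have "(int l)\<^sup>2 * (4 * u1\<^sup>2 - v1\<^sup>2) = 4 * u * u - v\<^sup>2"
      by (simp add: u1 v1 power2_eq_square algebra_simps)
    also have "\<dots> = (int l)\<^sup>2 * (- D)"
      unfolding disc det[symmetric] det_l minus_D ..
    finally have "4 * u1\<^sup>2 - v1\<^sup>2 = - D"
      using l0 by (simp only: mult_cancel_left power_eq_0_iff) simp
    then show "D = v1\<^sup>2 - 4 * u1\<^sup>2" by simp
  qed
  have D_neg: "D < 0"
  proof -
    have "a\<^sup>2 > 0" using a by simp
    then show ?thesis using D(2) bb by linarith
  qed
  have red: "reduced (BQF u v u)" "reduced (BQF u1 v1 u1)" using v_le v0 v1_le v1_0 by auto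
  have prim: "primitive (BQF u1 v1 u1)" using cop1 by (simp add: gcd.commute gcd.left_commute)
  have discr: "discr (BQF u1 v1 u1) = D" using D(1) by (simp add: power2_eq_square)
  have temp: "(temperament (map_bqf real_of_int F) M)\<^sup>2 = real l * (real_of_int u1 / real_of_int a)"
    unfolding temperament_squared[OF assms(2) k tp min att] U by (simp add: u1)
  have uvu: "in_coords F p q = BQF u v u" "in_coords F q p = BQF u v u"
    unfolding F_def p q in_coords_BQF using up uq v by (simp_all add: algebra_simps)
  have reduction: "reduction (in_coords F p' q') = BQF u v u" if basis: "int_basis M p' q'" for p' q'
  proof (rule reduction_rhombic[OF red(1)])
    obtain w z where wz: "p = lin_comb p' q' w" "q = lin_comb p' q' z" "\<bar>det2 w z\<bar> = 1"
      using basis_change_det[OF basis _ _ _ gen] mem pq(2) unfolding p q by (metis less_irrefl)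
    \<comment> \<open>The given basis may have the opposite orientation; exchanging \<open>p\<close>
      and \<open>q\<close> corrects this and leaves the form \<open>(u, v, u)\<close>
      unchanged.\<close>
    then have "det2 w z = 1 \<or> det2 z w = 1" using det2_swap[of w z] by auto
    then show "properly_equivalent (in_coords F p' q') (BQF u v u)"
      unfolding properly_equivalent_iff in_coords_lin_comb using wz(1,2) uvu by metis
  qed

  \<comment> \<open>Comparison of the coefficient rings\<close>
  let ?f = "field_embed (BQF a b a)"
  let ?R = "\<lambda>v. range (\<lambda>(m::int, n::int). of_int m + of_int n * ((of_int v + csqrt (of_int D)) / 2))"
  have image: "?f ` range (lin_comb r t) = range (\<lambda>(x::int, y::int). of_int x * ?f r + of_int y * ?f t)" for r t
    by (auto simp: image_image field_embed_lin_comb case_prod_unfold)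
  \<comment> \<open>\<open>Z^2\<close> itself is the case \<open>z = 1\<close> with the form
    \<open>(a, b, a)\<close>.\<close>
  have "coefficient_ring (quad_field D) (?f ` range (lin_comb (1, 0) (0, 1))) = ?R b"
    unfolding image
  proof (rule coefficient_ring_rhombic[OF a cop D(2) D_neg])
    show "?f (1, 0) \<noteq> 0" by simp
    show "2 * of_int a * ?f (0, 1) = (of_int b + csqrt (of_int D)) * ?f (1, 0)"
      using field_embed_ratio[of a D b a 1 0 b 0 1 1] a assms(8) by simp
  qed
  moreover have "range (lin_comb (1, 0) (0, 1)) = UNIV"
    by (simp add: lin_comb_def)
  ultimately have ring0: "coefficient_ring (quad_field D) (?f ` UNIV) = ?R b" by simp
  have "M = range (lin_comb p q)"
    using gen sublattice_lin_comb[OF assms(2) mem] unfolding p q by blast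
  moreover have "coefficient_ring (quad_field D) (?f ` range (lin_comb p q)) = ?R v1"
    unfolding image
  proof (rule coefficient_ring_rhombic[OF u1_pos cop1 D(1) D_neg])
    \<comment> \<open>The factor \<open>l\<close> of \<open>u\<close> and \<open>v\<close> cancels
      against the determinant in the ratio of the embedded vectors.\<close>
    have "of_int (int l) * (2 * of_int u1 * ?f q) = of_int (int l) * ((of_int v1 + csqrt (of_int D)) * ?f p)"
      using field_embed_ratio[OF _ assms(8) up v det_l[symmetric]] a p q
      by (simp add: u1 v1 algebra_simps)
    then show ratio: "2 * of_int u1 * ?f q = (of_int v1 + csqrt (of_int D)) * ?f p"
      using l0 by simp
    show "?f p \<noteq> 0"
    proof
      assume "?f p = 0"
      then have "p1 = 0 \<and> p2 = 0"
        using field_embed_eq_0[of a b a p1 p2] a D_neg assms(8) p by simp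
      then show False using det_l l0 by simp
    qed
  qed
  moreover have "?R v1 = ?R b"
  proof (rule generated_order_shift)
    \<comment> \<open>Equal discriminants force \<open>v1\<close> and \<open>b\<close> to have the
      same parity.\<close>
    have "v1\<^sup>2 - b\<^sup>2 = 4 * (u1\<^sup>2 - a\<^sup>2)" using D by simp
    then have "even (v1\<^sup>2 - b\<^sup>2)" by simp
    then show "even (v1 - b)" by simp
  qed
  ultimately have "coefficient_ring (quad_field D) (?f ` UNIV) = coefficient_ring (quad_field D) (?f ` M)"
    using ring0 by simp
  then show ?thesis
    using reduction gcd u1 v1 pos_def_rhombic[OF v1_le u1_pos] prim red(2) discr temp
    unfolding F_def by blast
qed

end
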